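(* Let $d\ge 1$ and let $f\in R^{\pm}=\mathbb{C}[x_1^{\pm1},\ldots,x_d^{\pm1}]$ be nonzero. The principal ideal $(f)\subseteq R^{\pm}$ is a power-closed ideal if and only if, up to multiplication by a unit of $R^{\pm}$, $$f=\prod_{i=1}^k f_i(\tilde{\xi}_i),$$ where the $\tilde{\xi}_i$ are distinct positive fractions of primitive pairs of monomials, for some term order on $[x_1,\ldots,x_d]$, and where each $f_i\in\mathbb{C}[x]$ is a nonzero power-polynomial, and therefore, up to multiplication by a unit of $\mathbb{C}[x^{\pm1}]$, is a product $\prod_{n\ge1}\phi_n(x)^{a_n}$ of cyclotomic polynomials with $a_m\ge a_n$ whenever $m\mid n$, and also is a product of psi-polynomials.
   Context: For $f\in R^{\pm}$ (and similarly for $f$ in one variable) and $i\in\mathbb{N}=\{1,2,\ldots\}$, $f^{(i)}=f(x_1^i,\ldots,x_d^i)$. An ideal $I$ of $R^{\pm}$ is power-closed if $f\in I$ implies $f^{(i)}\in I$ for every $i\in\mathbb{N}$. A polynomial $g\in\mathbb{C}[x]$ is a power-polynomial if $g(x)$ divides $g(x^i)$ for every $i\in\mathbb{N}$. $[x_1,\ldots,x_d]$ is the multiplicative monoid of monomials $\tilde{x}^{\tilde{p}}=x_1^{p_1}\cdots x_d^{p_d}$, $\tilde p\in\mathbb{Z}_{\ge0}^d$; a term order is a total well-order on it compatible with multiplication and having $1$ as least element. A pair $\tilde p,\tilde q$ of $d$-tuples of nonnegative integers is primitive if their supports $\{i:p_i\ne0\}$ and $\{i:q_i\neq 0\}$ are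 disjoint and the greatest common divisor of all coordinates of $\tilde p$ and $\tilde q$ together is $1$. A positive fraction of a primitive pair of monomials (with respect to a given term order) is an element $\tilde\xi=\tilde{x}^{\tilde q}/\tilde{x}^{\tilde p}\in R^{\pm}$ with $\tilde p,\tilde q$ primitive and $\tilde{x}^{\tilde q}>\tilde{x}^{\tilde p}$. $\phi_n$ is the $n$-th cyclotomic polynomial. A psi-polynomial is a polynomial of the form $\psi_A(x)=\mathrm{lcm}(x^a-1:a\in A)$, where $A$ is a finite antichain of $\mathbb{N}$ ordered by divisibility. *)

theory Defs
  imports
    "HOL-Library.Poly_Mapping"
    "HOL-Analysis.Finite_Cartesian_Product"
    "HOL-Computational_Algebra.Computational_Algebra"
    "HOL-Computational_Algebra.Field_as_Ring"
begin

text \<open>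
  Laurent polynomials are finitely supported functions on the exponent group with the
  convolution product: exponents \<open>int ^ 'd\<close> give \<open>\<complex>[x\<^sub>1\<^sup>\<plusminus>\<^sup>1, \<dots>, x\<^sub>d\<^sup>\<plusminus>\<^sup>1]\<close> with \<open>d = CARD('d) \<ge> 1\<close>, and
  exponents \<open>int\<close> give \<open>\<complex>[x\<^sup>\<plusminus>\<^sup>1]\<close>.
\<close>

type_synonym 'd laurent = "(int ^ 'd) \<Rightarrow>\<^sub>0 complex"
type_synonym laurent1 = "int \<Rightarrow>\<^sub>0 complex"

definition power_subst :: "nat \<Rightarrow> 'd::finite laurent \<Rightarrow> 'd laurent" where
  "power_subst i f = (\<Sum>a\<in>Poly_Mapping.keys f. Poly_Mapping.single (int i *s a) (Poly_Mapping.lookup f a))"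

text \<open>Ideals of a commutative ring are the submodules of the ring as a module over itself.\<close>

global_interpretation ideal: module "(*) :: 'a \<Rightarrow> 'a \<Rightarrow> 'a::comm_ring_1"
  by standard (simp_all add: algebra_simps)

definition power_closed_ideal :: "'d::finite laurent set \<Rightarrow> bool" where
  "power_closed_ideal I \<longleftrightarrow>
     ideal.subspace I \<and> (\<forall>f\<in>I. \<forall>i\<ge>1. power_subst i f \<in> I)"

definition power_polynomial :: "complex poly \<Rightarrow> bool" where
  "power_polynomial g \<longleftrightarrow> (\<forall>i\<ge>1. g dvd pcompose g (monom 1 i))"

text \<open>The monomials \<open>x\<^sup>p\<close> of \<open>[x\<^sub>1, \<dots>, x\<^sub>d]\<close> are represented by their exponent vectors \<open>p\<close>, so that
  the product of monomials is addition and \<open>1\<close> is \<open>0\<close>; \<open>(p, q) \<in> r\<close> means \<open>x\<^sup>p \<le> x\<^sup>q\<close>.\<close>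

definition term_order :: "(nat ^ 'd::finite) rel \<Rightarrow> bool" where
  "term_order r \<longleftrightarrow>
     well_order_on UNIV r \<and>
     (\<forall>p q s. (p, q) \<in> r \<longrightarrow> (p + s, q + s) \<in> r) \<and>
     (\<forall>p. (0, p) \<in> r)"

definition primitive_pair :: "nat ^ 'd::finite \<Rightarrow> nat ^ 'd \<Rightarrow> bool" where
  "primitive_pair p q \<longleftrightarrow>
     {i. p $ i \<noteq> 0} \<inter> {i. q $ i \<noteq> 0} = {} \<and>
     Gcd (range (($) p) \<union> range (($) q)) = 1"

definition positive_fraction :: "(nat ^ 'd::finite) rel \<Rightarrow> 'd laurent \<Rightarrow> bool" where
  "positive_fraction r \<xi> \<longleftrightarrow>
     (\<exists>p q. primitive_pair p q \<and> (p, q) \<in> r \<and> p \<noteq> q \<and>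
        \<xi> = Poly_Mapping.single (\<chi> i. int (q $ i) - int (p $ i)) 1)"

definition eval_at :: "complex poly \<Rightarrow> ('g::comm_monoid_add \<Rightarrow>\<^sub>0 complex) \<Rightarrow> ('g \<Rightarrow>\<^sub>0 complex)" where
  "eval_at g \<xi> = poly (map_poly (Poly_Mapping.single 0) g) \<xi>"

definition to_laurent1 :: "complex poly \<Rightarrow> laurent1" where
  "to_laurent1 g = eval_at g (Poly_Mapping.single 1 1)"

definition eq_up_to_unit :: "'a::comm_ring_1 \<Rightarrow> 'a \<Rightarrow> bool" where
  "eq_up_to_unit f g \<longleftrightarrow> (\<exists>u. u dvd 1 \<and> f = u * g)"

definition primitive_roots_of_unity :: "nat \<Rightarrow> complex set" where
  "primitive_roots_of_unity n = {z. z ^ n = 1 \<and> (\<forall>m\<in>{1..<n}. z ^ m \<noteq> 1)}"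

text \<open>Only meaningful for \<open>n \<ge> 1\<close>.\<close>

definition cyclotomic :: "nat \<Rightarrow> complex poly" where
  "cyclotomic n = (\<Prod>z\<in>primitive_roots_of_unity n. [:-z, 1:])"

definition finite_dvd_antichain :: "nat set \<Rightarrow> bool" where
  "finite_dvd_antichain A \<longleftrightarrow>
     finite A \<and> 0 \<notin> A \<and> (\<forall>a\<in>A. \<forall>b\<in>A. a dvd b \<longrightarrow> a = b)"

text \<open>\<open>Lcm\<close> on \<open>complex poly\<close> is the monic least common multiple, and \<open>Lcm {} = 1\<close>.\<close>

definition psi :: "nat set \<Rightarrow> complex poly" where
  "psi A = Lcm ((\<lambda>a. monom 1 a - 1) ` A)"

definition psi_polynomial :: "complex poly \<Rightarrow> bool" where
  "psi_polynomial g \<longleftrightarrow> (\<exists>A. finite_dvd_antichain A \<and> g = psi A)"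

end

theory Submission
  imports Defs
begin

text \<open>
Write \<open>x\<^sup>a\<close> for the monomial with exponent \<open>a\<close> and \<open>f\<^sup>(\<^sup>i\<^sup>)\<close> for the image of \<open>f\<close> under \<open>x \<mapsto> x\<^sup>i\<close>. This map is a ring
endomorphism, so the ideal \<open>(f)\<close> is power-closed iff \<open>f\<close> divides every \<open>f\<^sup>(\<^sup>i\<^sup>)\<close>. A product of values
\<open>g(\<xi>)\<close> of power-polynomials at monomials \<open>\<xi>\<close> has this property because \<open>g(x)\<close> divides \<open>g(x\<^sup>i)\<close>.

For the converse, let \<open>f\<close> be the sum of the \<open>c\<^sub>b x\<^sup>b\<close> with \<open>b\<close> in a finite set \<open>K\<close>, and fix \<open>a\<close> in \<open>K\<close>. Take
the polynomial \<open>P(t)\<close> that is \<open>t\<close> times the product of all \<open>t - x\<^sup>b\<close> with \<open>b \<noteq> a\<close>. The sum of the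
\<open>c\<^sub>b P(x\<^sup>b)\<close> is a combination of \<open>f\<^sup>(\<^sup>1\<^sup>), f\<^sup>(\<^sup>2\<^sup>), \<dots>\<close>, hence divisible by \<open>f\<close>, and only the summand \<open>b = a\<close> is
nonzero. So \<open>f\<close> divides the product of the binomials \<open>x\<^sup>a - x\<^sup>b\<close> (\<open>dvd_power_substs_imp_dvd_prod_diff\<close>). This is
Vandermonde elimination with the monomials as nodes. Up to a unit each binomial is \<open>x\<^sup>n\<^sup>v - 1\<close> with \<open>v\<close> primitive, and so a product of factors \<open>x\<^sup>v - z\<close> with \<open>z\<close> an \<open>n\<close>-th root of
unity; replacing \<open>v\<close> by \<open>- v\<close> where needed makes \<open>x\<^sup>v\<close> a positive fraction.

Each \<open>x\<^sup>v - z\<close> is prime. Write \<open>w \<bullet> v\<close> for the integer pairing \<open>dot w v\<close>. If \<open>w \<bullet> v = 1\<close>,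
then \<open>x\<^sup>a \<mapsto> z\<^bsup>w \<bullet> a\<^esup> x\<^bsup>a - (w \<bullet> a) v\<^esup>\<close> is a ring endomorphism with
kernel \<open>(x\<^sup>v - z)\<close>, and Laurent polynomials form a domain. Hence \<open>f\<close> is a unit times a product of such
primes (\<open>linear_factorization\<close>). Collecting the primes with the same \<open>v\<close> gives \<open>f\<close> as the product of
the \<open>g\<^sub>v(x\<^sup>v)\<close> up to a unit. Finally \<open>g\<^sub>v\<close> is a power-polynomial: the prime factors of \<open>g\<^sub>v(x\<^sup>v)\<close> divide no
\<open>g\<^sub>u(x\<^sup>i\<^sup>u)\<close> with \<open>u \<noteq> v\<close>, because the endomorphism above sends \<open>x\<^sup>i\<^sup>u\<close> to a nonconstant monomial. So
divisibility of \<open>f\<^sup>(\<^sup>i\<^sup>)\<close> by \<open>f\<close> forces \<open>g\<^sub>v(x\<^sup>v)\<close> to divide \<open>g\<^sub>v(x\<^sup>i\<^sup>v)\<close> (\<open>power_dvd_imp_product\<close>).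

In one variable everything is read off from root multiplicities. The map \<open>x \<mapsto> x\<^sup>i\<close> is
unramified away from \<open>0\<close>, so the multiplicity of a power-polynomial \<open>g \<noteq> 0\<close> at \<open>z \<noteq> 0\<close> is at most
that at \<open>z\<^sup>i\<close> (\<open>power_polynomial_order_le\<close>). Since \<open>g\<close> has finitely many
roots, its nonzero roots are roots of unity; primitive \<open>n\<close>-th roots of unity are powers of each other,
so they share one multiplicity \<open>a\<^sub>n\<close>, and \<open>a\<^sub>n \<le> a\<^sub>m\<close> if \<open>m\<close> divides \<open>n\<close>. Each level set \<open>{n. a\<^sub>n \<ge> k}\<close> is
therefore closed under divisors, and the psi-polynomial of its maximal elements has exactly the
corresponding roots, all simple; the product over \<open>k\<close> has the multiplicities of \<open>g\<close>.
\<close>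

section \<open>Substitutions between monoid algebras\<close>

text \<open>
For a ring acting on itself the scaling rule re-associates products to the left, against the usual
normal form of products.
\<close>

declare ideal.scale_scale [simp del]

lemma poly_mapping_induct_sum [case_names single add]:
  fixes f :: "'g \<Rightarrow>\<^sub>0 'a::comm_monoid_add"
  assumes single: "\<And>a c. P (Poly_Mapping.single a c)"
    and add: "\<And>f g. P f \<Longrightarrow> P g \<Longrightarrow> P (f + g)"
  shows "P f"
proof -
  have decomp: "f = (\<Sum>a\<in>Poly_Mapping.keys f. Poly_Mapping.single a (Poly_Mapping.lookup f a))"
    by (rule poly_mapping_eqI)
      (auto simp: lookup_sum lookup_single when_def in_keys_iff sum.delta')
  have "P (\<Sum>a\<in>A. Poly_Mapping.single a (Poly_Mapping.lookup f a))" if "finite A" for A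
    using that
  proof (induction A)
    case empty
    then show ?case using single[of undefined 0] by simp
  qed (simp add: single add)
  then show ?thesis by (subst decomp) simp
qed

text \<open>
The ring homomorphisms \<open>x\<^sup>a \<mapsto> \<eta>(a) x\<^bsup>h(a)\<^esup>\<close> for a character \<open>\<eta>\<close> and an additive map \<open>h\<close>. Three instances
carry the proof: the power maps, Kronecker substitution into one variable, and the reduction
modulo a factor \<open>x\<^sup>v - z\<close>.
\<close>

locale twisted_substitution =
  fixes \<eta> :: "'g::comm_monoid_add \<Rightarrow> complex" and h :: "'g \<Rightarrow> 'h::comm_monoid_add"
  assumes character_zero: "\<eta> 0 = 1" and character_add: "\<And>a b. \<eta> (a + b) = \<eta> a * \<eta> b"
    and exponent_zero: "h 0 = 0" and exponent_add: "\<And>a b. h (a + b) = h a + h b"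
begin

definition subst :: "('g \<Rightarrow>\<^sub>0 complex) \<Rightarrow> ('h \<Rightarrow>\<^sub>0 complex)" where
  "subst f = (\<Sum>a\<in>Poly_Mapping.keys f. Poly_Mapping.single (h a) (\<eta> a * Poly_Mapping.lookup f a))"

lemma subst_superset:
  assumes "finite S" "Poly_Mapping.keys f \<subseteq> S"
  shows "subst f = (\<Sum>a\<in>S. Poly_Mapping.single (h a) (\<eta> a * Poly_Mapping.lookup f a))"
  unfolding subst_def using assms by (intro sum.mono_neutral_left) (auto simp: in_keys_iff)

lemma subst_single: "subst (Poly_Mapping.single a c) = Poly_Mapping.single (h a) (\<eta> a * c)"
  by (simp add: subst_superset[of "{a}"])

lemma subst_zero [simp]: "subst 0 = 0"
  by (simp add: subst_def)

lemma subst_one [simp]: "subst 1 = 1"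
  by (metis subst_single character_zero exponent_zero mult_1 single_one)

lemma subst_add: "subst (f + g) = subst f + subst g"
proof -
  let ?S = "Poly_Mapping.keys f \<union> Poly_Mapping.keys g"
  have "Poly_Mapping.keys (f + g) \<subseteq> ?S"
    by (rule keys_add)
  then show ?thesis
    by (simp add: subst_superset[of ?S] lookup_add distrib_left single_add sum.distrib)
qed

lemma subst_uminus: "subst (- f) = - subst f"
  by (simp add: subst_def single_uminus sum_negf)

lemma subst_diff: "subst (f - g) = subst f - subst g"
  using subst_add[of f "- g"] by (simp add: subst_uminus)

lemma subst_mult: "subst (f * g) = subst f * subst g"
proof (induction f rule: poly_mapping_induct_sum)
  case (single a c)
  show ?case
  proof (induction g rule: poly_mapping_induct_sum)
    case (single b d)
    show ?case
      unfolding mult_single subst_single character_add exponent_add by (simp only: mult_ac)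
  next
    case (add g1 g2)
    then show ?case by (simp only: distrib_left subst_add)
  qed
next
  case (add f1 f2)
  then show ?case by (simp only: distrib_right subst_add)
qed

lemma subst_prod: "subst (\<Prod>i\<in>A. F i) = (\<Prod>i\<in>A. subst (F i))"
  by (induction A rule: infinite_finite_induct) (simp_all add: subst_mult)

lemma subst_dvd: "f dvd g \<Longrightarrow> subst f dvd subst g"
  by (auto simp: dvd_def subst_mult)

end

section \<open>Evaluation of polynomials at elements of a monoid algebra\<close>

lemma eval_at_0 [simp]: "eval_at 0 \<xi> = 0"
  by (simp add: eval_at_def)

lemma eval_at_pCons: "eval_at (pCons c p) \<xi> = Poly_Mapping.single 0 c + \<xi> * eval_at p \<xi>"
  by (cases "c = 0 \<and> p = 0") (auto simp: eval_at_def map_poly_pCons)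

lemma eval_at_const: "eval_at [:c:] \<xi> = Poly_Mapping.single 0 c"
  by (simp add: eval_at_pCons)

lemma eval_at_1 [simp]: "eval_at 1 \<xi> = 1"
  by (metis eval_at_const one_pCons single_one)

lemma eval_at_add: "eval_at (p + q) \<xi> = eval_at p \<xi> + eval_at q \<xi>"
  by (induction p q rule: poly_induct2) (simp_all add: eval_at_pCons single_add algebra_simps)

lemma eval_at_diff: "eval_at (p - q) \<xi> = eval_at p \<xi> - eval_at q \<xi>"
  using eval_at_add[of "p - q" q \<xi>] by simp

lemma eval_at_smult: "eval_at (smult c p) \<xi> = Poly_Mapping.single 0 c * eval_at p \<xi>"
proof (induction p)
  case (pCons a p)
  then show ?case
    by (simp add: eval_at_pCons distrib_left mult_single mult.left_commute)
qed simp

lemma eval_at_mult: "eval_at (p * q) \<xi> = eval_at p \<xi> * eval_at q \<xi>"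
proof (induction p)
  case (pCons a p)
  then show ?case
    by (simp add: eval_at_pCons eval_at_add eval_at_smult distrib_right mult.assoc)
qed simp

lemma eval_at_power: "eval_at (p ^ n) \<xi> = eval_at p \<xi> ^ n"
  by (induction n) (simp_all add: eval_at_mult)

lemma eval_at_prod_mset: "eval_at (prod_mset M) \<xi> = (\<Prod>p\<in>#M. eval_at p \<xi>)"
  by (induction M) (simp_all add: eval_at_mult)

lemma eval_at_dvd: "p dvd q \<Longrightarrow> eval_at p \<xi> dvd eval_at q \<xi>"
  by (auto simp: dvd_def eval_at_mult)

lemma eval_at_pcompose: "eval_at (pcompose p q) \<xi> = eval_at p (eval_at q \<xi>)"
  by (induction p)
    (simp_all add: pcompose_pCons eval_at_pCons eval_at_add eval_at_mult)

lemma eval_at_monom: "eval_at (monom 1 n) \<xi> = \<xi> ^ n"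
  by (induction n) (simp_all add: monom_Suc eval_at_pCons flip: one_pCons monom_0)

lemma eval_at_single_0: "eval_at p (Poly_Mapping.single 0 c) = Poly_Mapping.single 0 (poly p c)"
  by (induction p) (simp_all add: eval_at_pCons mult_single single_add)

lemma (in twisted_substitution) subst_eval_at: "subst (eval_at p \<xi>) = eval_at p (subst \<xi>)"
  by (induction p)
    (simp_all add: eval_at_pCons subst_add subst_mult subst_single character_zero exponent_zero)

lemma power_single: "Poly_Mapping.single v c ^ n = Poly_Mapping.single (int n *s v) (c ^ n)"
  for v :: "int ^ 'd::finite" and c :: complex
  by (induction n) (simp_all add: mult_single vector_sadd_rdistrib algebra_simps)

section \<open>Laurent polynomials form an integral domain\<close>

definition dot :: "int ^ 'd::finite \<Rightarrow> int ^ 'd \<Rightarrow> int" where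
  "dot w v = (\<Sum>i\<in>UNIV. w $ i * v $ i)"

lemma dot_0 [simp]: "dot w 0 = 0" and dot_add: "dot w (u + v) = dot w u + dot w v"
  and dot_diff: "dot w (u - v) = dot w u - dot w v" and dot_scale: "dot w (c *s v) = c * dot w v"
  by (simp_all add: dot_def distrib_left sum.distrib right_diff_distrib sum_subtractf sum_distrib_left
      mult.left_commute)

text \<open>
The linear forms \<open>w = (x\<^bsup>e(i)\<^esup>)\<^sub>i\<close> with distinct exponents \<open>e(i)\<close> suffice: \<open>dot w v\<close> is then a nonzero
polynomial in \<open>x\<close>, so each \<open>v\<close> excludes only finitely many integers \<open>x\<close>.
\<close>

lemma exists_dot_nonzero:
  fixes S :: "(int ^ 'd::finite) set"
  assumes "finite S" "0 \<notin> S"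
  shows "\<exists>w. \<forall>v\<in>S. dot w v \<noteq> 0"
proof -
  obtain e :: "'d \<Rightarrow> nat" where e: "inj e"
    using finite_imp_inj_to_nat_seg[of "UNIV :: 'd set"] by auto
  define q :: "int ^ 'd \<Rightarrow> int poly" where "q v = (\<Sum>i\<in>UNIV. monom (v $ i) (e i))" for v
  have coeff: "coeff (q v) (e i) = v $ i" for v i
    using e by (simp add: q_def coeff_sum inj_eq sum.delta')
  have "q v \<noteq> 0" if "v \<in> S" for v
  proof
    assume "q v = 0"
    then have "v = 0" using coeff[of v] by (simp add: vec_eq_iff)
    with that assms show False by simp
  qed
  then have "finite (\<Union>v\<in>S. {x. poly (q v) x = 0})"
    using assms(1) by (auto intro: poly_roots_finite)
  then obtain x where x: "x \<notin> (\<Union>v\<in>S. {x. poly (q v) x = 0})"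
    using infinite_UNIV_int ex_new_if_finite by blast
  have "dot (\<chi> i. x ^ e i) v = poly (q v) x" for v
    by (simp add: dot_def q_def poly_sum poly_monom mult.commute)
  with x show ?thesis by (intro exI[of _ "\<chi> i. x ^ e i"]) auto
qed

lemma twisted_substitution_dot: "twisted_substitution (\<lambda>_. 1) (dot w)"
  by unfold_locales (simp_all add: dot_add)

text \<open>
Kronecker substitution along a linear form that separates the exponents of \<open>f\<close> and \<open>g\<close> maps both to
nonzero Laurent polynomials in one variable, which form a domain because \<open>\<int>\<close> is an ordered group.
\<close>

lemma laurent_no_zero_divisors:
  fixes f g :: "'d::finite laurent"
  assumes "f * g = 0"
  shows "f = 0 \<or> g = 0"
proof (rule ccontr)
  assume nz: "\<not> (f = 0 \<or> g = 0)"
  let ?K = "Poly_Mapping.keys f \<union> Poly_Mapping.keys g"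
  obtain w where w: "\<forall>v\<in>(\<lambda>(a, b). a - b) ` (?K \<times> ?K) - {0}. dot w v \<noteq> 0"
    using exists_dot_nonzero[of "(\<lambda>(a, b). a - b) ` (?K \<times> ?K) - {0}"] by auto
  have inj: "inj_on (dot w) ?K"
    using w by (force simp: inj_on_def dot_diff)
  interpret kronecker: twisted_substitution "\<lambda>_. 1" "dot w"
    by (rule twisted_substitution_dot)
  have "kronecker.subst p \<noteq> 0" if "p \<noteq> 0" and sub: "Poly_Mapping.keys p \<subseteq> ?K" for p
  proof -
    from \<open>p \<noteq> 0\<close> obtain a where a: "a \<in> Poly_Mapping.keys p"
      using keys_eq_empty by blast
    have "Poly_Mapping.lookup (kronecker.subst p) (dot w a) =
        (\<Sum>b\<in>Poly_Mapping.keys p. if b = a then Poly_Mapping.lookup p b else 0)"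
      unfolding kronecker.subst_def lookup_sum
      using inj_on_subset[OF inj sub] a by (intro sum.cong) (auto simp: lookup_single when_def inj_on_eq_iff)
    also have "\<dots> \<noteq> 0" using a by (simp add: in_keys_iff)
    finally show ?thesis by auto
  qed
  then have "kronecker.subst f * kronecker.subst g \<noteq> 0"
    using nz by simp
  then show False
    using assms by (simp flip: kronecker.subst_mult)
qed

lemma laurent_mult_left_cancel:
  fixes f g h :: "'d::finite laurent"
  assumes "f * g = f * h" "f \<noteq> 0"
  shows "g = h"
  using laurent_no_zero_divisors[of f "g - h"] assms by (simp add: right_diff_distrib)

section \<open>Units and associated elements\<close>

lemma single_unit: "Poly_Mapping.single v c dvd 1" if "c \<noteq> 0" for v :: "'g::ab_group_add" and c :: complex
proof
  show "1 = Poly_Mapping.single v c * Poly_Mapping.single (- v) (1 / c)"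
    using that by (simp add: mult_single)
qed

lemma dvd_unit_cancel:
  fixes u a b :: "'a::comm_ring_1"
  assumes "u dvd 1" "a dvd u * b"
  shows "a dvd b"
proof -
  from assms(1) obtain v where "1 = u * v" by (auto simp: dvd_def)
  then have "b = v * (u * b)"
    by (metis mult.assoc mult.commute mult_1)
  with assms(2) show ?thesis by (metis dvd_mult)
qed

lemma mutual_dvd_imp_eq_up_to_unit:
  fixes a b :: "'a::idom"
  assumes "a dvd b" "b dvd a"
  shows "eq_up_to_unit a b"
proof (cases "b = 0")
  case True
  with assms show ?thesis by (auto simp: eq_up_to_unit_def intro: exI[of _ 1])
next
  case False
  from assms(1) obtain k where "b = a * k" ..
  moreover from assms(2) obtain l where "a = b * l" ..
  ultimately have "l * k = 1" using False by (metis mult.assoc mult_cancel_left1)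
  with \<open>a = b * l\<close> show ?thesis
    unfolding eq_up_to_unit_def by (intro exI[of _ l]) (auto simp: dvd_def mult.commute)
qed

section \<open>Root multiplicities of complex polynomials\<close>

lemma order_prod:
  fixes F :: "'i \<Rightarrow> 'a::idom poly"
  assumes "\<And>i. i \<in> A \<Longrightarrow> F i \<noteq> 0"
  shows "order z (\<Prod>i\<in>A. F i) = (\<Sum>i\<in>A. order z (F i))"
  using assms by (induction A rule: infinite_finite_induct) (simp_all add: order_mult)

lemma order_power_eq:
  fixes p :: "'a::idom poly"
  shows "p \<noteq> 0 \<Longrightarrow> order z (p ^ n) = n * order z p"
  by (induction n) (simp_all add: order_mult)

lemma order_prod_list:
  fixes ps :: "'a::idom poly list"
  assumes "0 \<notin> set ps"
  shows "order z (prod_list ps) = (\<Sum>p\<leftarrow>ps. order z p)"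
  using assms by (induction ps) (auto simp: order_mult prod_list_zero_iff)

lemma order_linear: "order (z :: complex) [:-w, 1:] = (if z = w then 1 else 0)"
  using order_power_n_n[of w 1] by (auto intro: order_0I)

lemma order_prod_linear:
  assumes "finite Z"
  shows "order (z :: complex) (\<Prod>w\<in>Z. [:-w, 1:]) = (if z \<in> Z then 1 else 0)"
  using assms by (simp add: order_prod order_linear)

lemma dvd_iff_order_le:
  fixes p q :: "complex poly"
  assumes "p \<noteq> 0" "q \<noteq> 0"
  shows "p dvd q \<longleftrightarrow> (\<forall>z. order z p \<le> order z q)"
proof (intro iffI allI)
  show "order z p \<le> order z q" if "p dvd q" for z
    using assms(2) that by (rule dvd_imp_order_le)
next
  assume le: "\<forall>z. order z p \<le> order z q"
  let ?P = "\<Prod>z | poly p z = 0. [:-z, 1:] ^ order z p" and ?Q = "\<Prod>z | poly q z = 0. [:-z, 1:] ^ order z q"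
  have "?P dvd ?Q"
  proof (rule prod_dvd_prod_subset2)
    show "finite {z. poly q z = 0}" using assms(2) by (rule poly_roots_finite)
    show "{z. poly p z = 0} \<subseteq> {z. poly q z = 0}"
    proof clarify
      fix z assume "poly p z = 0"
      then have "order z p > 0" using assms by (simp add: order_root)
      then have "order z q > 0" using le by (metis order_less_le_trans)
      then show "poly q z = 0" by (simp add: order_root)
    qed
  qed (use le in \<open>auto intro: le_imp_power_dvd\<close>)
  then have "smult (lead_coeff p) ?P dvd smult (lead_coeff q) ?Q"
    using assms by (simp add: smult_dvd_iff dvd_smult)
  then show "p dvd q" by (simp only: complex_poly_decompose)
qed

lemma monom_minus_const_nonzero:
  assumes "n \<ge> 1"
  shows "monom 1 n - [:w:] \<noteq> (0 :: complex poly)"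
proof
  assume "monom 1 n - [:w:] = 0"
  then have "coeff (monom 1 n - [:w:]) n = 0" by simp
  with assms show False by (cases n) auto
qed

lemma order_monom_minus_const:
  fixes z w :: complex
  assumes "n \<ge> 1" "z \<noteq> 0"
  shows "order z (monom 1 n - [:w:]) = (if z ^ n = w then 1 else 0)"
proof (cases "z ^ n = w")
  case True
  let ?p = "monom 1 n - [:w:]"
  have root: "poly ?p z = 0" using True by (simp add: poly_monom)
  have pd: "poly (pderiv ?p) z \<noteq> 0"
    using assms by (simp add: pderiv_diff pderiv_monom poly_monom pderiv_pCons)
  then have nz: "pderiv ?p \<noteq> 0" by auto
  then have "?p \<noteq> 0" by auto
  from order_pderiv[OF \<open>?p \<noteq> 0\<close> root] show ?thesis
    using True pd by (simp add: order_0I)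
qed (simp add: order_0I poly_monom)

text \<open>
At a point \<open>z \<noteq> 0\<close> the map \<open>x \<mapsto> x\<^sup>i\<close> is unramified, so it preserves multiplicities.
\<close>

lemma order_pcompose_monom:
  fixes g :: "complex poly"
  assumes "g \<noteq> 0" "z \<noteq> 0" "i \<ge> 1"
  shows "order z (pcompose g (monom 1 i)) = order (z ^ i) g"
proof -
  let ?w = "z ^ i" and ?e = "order (z ^ i) g"
  obtain q where q: "g = [:-?w, 1:] ^ ?e * q" "\<not> [:-?w, 1:] dvd q"
    using order_decomp[OF assms(1)] by blast
  have "poly q ?w \<noteq> 0" using q(2) by (simp add: poly_eq_0_iff_dvd)
  then have ord_q: "order z (pcompose q (monom 1 i)) = 0"
    by (intro order_0I) (simp add: poly_pcompose poly_monom)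
  have nz: "pcompose q (monom 1 i) \<noteq> 0"
    using \<open>poly q ?w \<noteq> 0\<close> by (metis poly_0 poly_pcompose poly_monom mult_1)
  have lin: "pcompose [:-?w, 1:] (monom 1 i) = monom 1 i - [:?w:]"
    by (simp add: pcompose_pCons)
  have pow: "pcompose (p ^ n) r = pcompose p r ^ n" for p r :: "complex poly" and n
    by (induction n) (simp_all add: pcompose_mult pcompose_1)
  have lin_nz: "monom 1 i - [:?w:] \<noteq> (0 :: complex poly)"
    using assms(3) by (rule monom_minus_const_nonzero)
  have "pcompose g (monom 1 i) = (monom 1 i - [:?w:]) ^ ?e * pcompose q (monom 1 i)"
    by (subst q(1)) (simp add: pcompose_mult pow lin)
  then have "order z (pcompose g (monom 1 i)) = order z ((monom 1 i - [:?w:]) ^ ?e * pcompose q (monom 1 i))"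
    by simp
  also have "\<dots> = ?e"
    using lin_nz nz ord_q assms by (simp add: order_mult order_power_eq order_monom_minus_const)
  finally show ?thesis .
qed

lemma pcompose_monom_nonzero:
  fixes g :: "complex poly"
  shows "g \<noteq> 0 \<Longrightarrow> i \<ge> 1 \<Longrightarrow> pcompose g (monom 1 i) \<noteq> 0"
  by (metis degree_monom_eq dvd_0_left_iff not_one_le_zero one_neq_zero pcompose_eq_0_iff nat_less_le not_less_zero less_one not_gr_zero linorder_not_less)

section \<open>Multiplicities of power-polynomials\<close>

lemma power_polynomial_order_le:
  assumes "power_polynomial g" "g \<noteq> 0" "z \<noteq> 0" "i \<ge> 1"
  shows "order z g \<le> order (z ^ i) g"
proof -
  have "order z g \<le> order z (pcompose g (monom 1 i))"
    using assms pcompose_monom_nonzero by (intro dvd_imp_order_le) (auto simp: power_polynomial_def)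
  with assms show ?thesis by (simp add: order_pcompose_monom)
qed

lemma power_eq_imp_root_of_unity:
  fixes z :: complex
  assumes "z \<noteq> 0" "i < j" "z ^ i = z ^ j"
  shows "z ^ (j - i) = 1"
proof -
  have "z ^ i * z ^ (j - i) = z ^ i * 1"
    using assms(2,3) by (metis le_add_diff_inverse less_imp_le_nat mult_1_right power_add)
  with assms(1) show ?thesis by simp
qed

text \<open>
All powers of a root are roots; since there are finitely many, two of them agree.
\<close>

lemma power_polynomial_root_of_unity:
  assumes "power_polynomial g" "g \<noteq> 0" "z \<noteq> 0" "order z g \<noteq> 0"
  shows "\<exists>m\<ge>1. z ^ m = 1"
proof -
  have "poly g (z ^ i) = 0" if "i \<ge> 1" for i
    using power_polynomial_order_le[OF assms(1-3) that] assms(4) by (simp add: order_root)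
  then have "(\<lambda>i. z ^ i) ` {1..} \<subseteq> {w. poly g w = 0}" by auto
  then have "finite ((\<lambda>i. z ^ i) ` {1..})"
    using poly_roots_finite[OF assms(2)] finite_subset by blast
  then have "\<not> inj_on (\<lambda>i. z ^ i) {1..}"
    using finite_imageD infinite_Ici by blast
  then obtain i j where "i < j" "z ^ i = z ^ j"
    by (metis (mono_tags, lifting) inj_on_def linorder_neqE_nat)
  then show ?thesis
    using power_eq_imp_root_of_unity[OF assms(3)] by (intro exI[of _ "j - i"]) auto
qed

section \<open>Primitive roots of unity\<close>

lemma primitive_root_nonzero: "z \<in> primitive_roots_of_unity n \<Longrightarrow> n \<ge> 1 \<Longrightarrow> z \<noteq> 0"
  by (auto simp: primitive_roots_of_unity_def power_0_left)

lemma primitive_root_power_eq_1_iff: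
  assumes "z \<in> primitive_roots_of_unity n" "n \<ge> 1"
  shows "z ^ m = 1 \<longleftrightarrow> n dvd m"
proof -
  have "z ^ m = z ^ (n * (m div n) + m mod n)" by simp
  also have "\<dots> = z ^ (m mod n)"
    using assms(1) by (simp only: power_add power_mult primitive_roots_of_unity_def) simp
  finally have "z ^ m = z ^ (m mod n)" .
  moreover have "z ^ (m mod n) \<noteq> 1" if "m mod n \<noteq> 0"
    using that assms by (simp add: primitive_roots_of_unity_def)
  ultimately show ?thesis
    by (metis dvd_eq_mod_eq_0 power_0)
qed

lemma root_of_unity_is_primitive:
  assumes "z ^ m = 1" "m \<ge> 1"
  obtains n where "n \<ge> 1" "z \<in> primitive_roots_of_unity n"
proof
  let ?P = "\<lambda>n. n \<ge> 1 \<and> z ^ n = 1"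
  have "?P (Least ?P)" using assms by (intro LeastI[of ?P m]) simp
  then show "Least ?P \<ge> 1" by simp
  show "z \<in> primitive_roots_of_unity (Least ?P)"
    using \<open>?P (Least ?P)\<close> not_less_Least[of _ ?P] by (auto simp: primitive_roots_of_unity_def)
qed

lemma primitive_root_cis:
  assumes "n \<ge> 1"
  shows "cis (2 * pi / real n) \<in> primitive_roots_of_unity n"
proof -
  let ?f = "\<lambda>k. cis (2 * pi * real k / real n)"
  have bij: "bij_betw ?f {..<n} {z. z ^ n = 1}"
    using assms by (intro bij_betw_roots_unity) simp
  have pow: "cis (2 * pi / real n) ^ k = ?f k" for k
    by (simp add: DeMoivre mult.commute)
  have "?f k \<noteq> 1" if "k \<in> {1..<n}" for k
    using inj_onD[OF bij_betw_imp_inj_on[OF bij], of k 0] that by auto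
  moreover have "cis (2 * pi / real n) ^ n = 1"
    using assms by (simp add: pow)
  ultimately show ?thesis by (simp add: primitive_roots_of_unity_def pow)
qed

text \<open>
The powers \<open>z, z\<^sup>2, \<dots>, z\<^sup>n\<close> are \<open>n\<close> distinct \<open>n\<close>-th roots of unity, hence all of them.
\<close>

lemma primitive_root_generates:
  assumes "z \<in> primitive_roots_of_unity n" "n \<ge> 1" "w ^ n = 1"
  obtains i where "i \<ge> 1" "w = z ^ i"
proof -
  have "z \<noteq> 0" using assms by (simp add: primitive_root_nonzero)
  have "inj_on (\<lambda>i. z ^ i) {1..n}"
  proof (rule linorder_inj_onI)
    fix i j assume "i < j" "i \<in> {1..n}" "j \<in> {1..n}"
    show "z ^ i \<noteq> z ^ j"
    proof
      assume "z ^ i = z ^ j"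
      then have "n dvd j - i"
        using power_eq_imp_root_of_unity[OF \<open>z \<noteq> 0\<close> \<open>i < j\<close>]
          primitive_root_power_eq_1_iff[OF assms(1,2)] by simp
      with \<open>i < j\<close> \<open>i \<in> {1..n}\<close> \<open>j \<in> {1..n}\<close> show False by (auto dest: dvd_imp_le)
    qed
  qed auto
  moreover have "(\<lambda>i. z ^ i) ` {1..n} \<subseteq> {w. w ^ n = 1}"
    using assms(1) by (auto simp: primitive_roots_of_unity_def simp flip: power_mult)
      (metis mult.commute power_mult power_one)
  ultimately have "(\<lambda>i. z ^ i) ` {1..n} = {w. w ^ n = 1}"
    using assms(2) by (intro card_subset_eq) (auto simp: card_image card_roots_unity_eq finite_roots_unity)
  with assms(3) have "w \<in> (\<lambda>i. z ^ i) ` {1..n}" by simp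
  with that show ?thesis by auto
qed

lemma finite_primitive_roots: "n \<ge> 1 \<Longrightarrow> finite (primitive_roots_of_unity n)"
  by (rule finite_subset[OF _ finite_roots_unity[of n]]) (auto simp: primitive_roots_of_unity_def)

section \<open>Cyclotomic and psi-polynomials\<close>

lemma order_cyclotomic:
  "n \<ge> 1 \<Longrightarrow> order z (cyclotomic n) = (if z \<in> primitive_roots_of_unity n then 1 else 0)"
  unfolding cyclotomic_def by (intro order_prod_linear finite_primitive_roots)

lemma psi_nonzero:
  assumes "finite_dvd_antichain A"
  shows "psi A \<noteq> 0"
proof -
  have "monom 1 a \<noteq> (1 :: complex poly)" if "a \<in> A" for a
    using assms that degree_monom_eq[of "1::complex" a]
    by (auto simp: finite_dvd_antichain_def)
  then show ?thesis
    using assms by (auto simp: psi_def finite_dvd_antichain_def Lcm_0_iff)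
qed

text \<open>
The roots of \<open>x\<^sup>a - 1\<close> are simple, so the least common multiple divides the product of \<open>x - w\<close> over the
union of all these roots.
\<close>

lemma order_psi:
  assumes A: "finite_dvd_antichain A" and "z \<noteq> 0"
  shows "order z (psi A) = (if \<exists>a\<in>A. z ^ a = 1 then 1 else 0)"
proof -
  have A': "finite A" "0 \<notin> A" using A by (auto simp: finite_dvd_antichain_def)
  let ?Z = "\<Union>a\<in>A. {w :: complex. w ^ a = 1}"
  let ?P = "\<Prod>w\<in>?Z. [:-w, 1:]"
  have "finite ?Z"
    using A' by (intro finite_UN_I finite_roots_unity) (auto simp: Suc_le_eq intro: gr0I)
  have P: "order w ?P = (if w \<in> ?Z then 1 else 0)" for w
    using \<open>finite ?Z\<close> by (rule order_prod_linear)
  have "?P \<noteq> 0" using \<open>finite ?Z\<close> by simp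
  have ord: "order w (monom 1 a - 1) = (if w ^ a = 1 then 1 else 0)" if "a \<in> A" for w :: complex and a
  proof (cases "w = 0")
    case True
    have "a > 0" using that A' by (cases a) auto
    with True show ?thesis by (auto intro!: order_0I simp: poly_monom power_0_left)
  next
    case False
    have "a \<ge> 1" using that A' by (cases a) auto
    then show ?thesis using order_monom_minus_const[OF \<open>a \<ge> 1\<close> False, of 1] by (simp add: one_pCons)
  qed
  have nz: "monom 1 a - 1 \<noteq> (0 :: complex poly)" if "a \<in> A" for a
    using A' that degree_monom_eq[of "1::complex" a] by (auto simp: )
  have "psi A dvd ?P"
    unfolding psi_def
  proof (rule Lcm_least)
    fix p :: "complex poly" assume "p \<in> (\<lambda>a. monom 1 a - 1) ` A"
    then obtain a where a: "a \<in> A" "p = monom 1 a - 1" by auto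
    show "p dvd ?P"
      unfolding a(2) using a(1) by (auto simp: dvd_iff_order_le[OF nz[OF a(1)] \<open>?P \<noteq> 0\<close>] P ord)
  qed
  then have upper: "order z (psi A) \<le> order z ?P"
    using \<open>?P \<noteq> 0\<close> by (rule dvd_imp_order_le[rotated])
  have lower: "1 \<le> order z (psi A)" if "a \<in> A" "z ^ a = 1" for a
  proof -
    have "monom 1 a - 1 dvd psi A" unfolding psi_def using that by (intro dvd_Lcm) auto
    then have "order z (monom 1 a - 1) \<le> order z (psi A)"
      using psi_nonzero[OF A] by (rule dvd_imp_order_le[rotated])
    with that show ?thesis by (simp add: ord)
  qed
  show ?thesis using upper lower by (force simp: P split: if_splits)
qed

text \<open>
Multiplication by a power of \<open>x\<close>, a unit of \<open>\<complex>[x\<^sup>\<plusminus>\<^sup>1]\<close>, raises the multiplicity at \<open>0\<close> and no other one.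
\<close>

lemma to_laurent1_dvd:
  assumes "p \<noteq> 0" "q \<noteq> 0" and le: "\<And>z. z \<noteq> 0 \<Longrightarrow> order z p \<le> order z q"
  shows "to_laurent1 p dvd to_laurent1 q"
proof -
  let ?X = "[:0, 1:] :: complex poly"
  have [simp]: "order z ?X = (if z = 0 then 1 else 0)" for z
    using order_linear[of z 0] by simp
  have "p dvd ?X ^ order 0 p * q"
    using assms by (auto simp: dvd_iff_order_le order_mult order_power_eq)
  then have "to_laurent1 p dvd to_laurent1 ?X ^ order 0 p * to_laurent1 q"
    by (metis to_laurent1_def eval_at_dvd eval_at_mult eval_at_power)
  moreover have "to_laurent1 ?X = Poly_Mapping.single 1 1"
    by (simp add: to_laurent1_def eval_at_pCons)
  moreover have "Poly_Mapping.single (1::int) (1::complex) ^ order 0 p dvd 1"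
    using single_unit[of 1 1] by (metis one_neq_zero dvd_power_same power_one)
  ultimately show ?thesis by (metis dvd_unit_cancel)
qed

lemma to_laurent1_eq_up_to_unit:
  assumes "p \<noteq> 0" "q \<noteq> 0" "\<And>z. z \<noteq> 0 \<Longrightarrow> order z p = order z q"
  shows "eq_up_to_unit (to_laurent1 p) (to_laurent1 q)"
  using assms by (intro mutual_dvd_imp_eq_up_to_unit to_laurent1_dvd) simp_all

section \<open>Factorizations of power-polynomials\<close>

text \<open>
The root \<open>exp (2\<pi>i/n)\<close> stands for all primitive \<open>n\<close>-th roots of unity: they have the same multiplicity
in a power-polynomial.
\<close>

definition cyclotomic_exponent :: "complex poly \<Rightarrow> nat \<Rightarrow> nat" where
  "cyclotomic_exponent g n = order (cis (2 * pi / real n)) g"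

text \<open>
Two primitive \<open>n\<close>-th roots of unity are powers of each other, so their multiplicities bound each other.
\<close>

lemma cyclotomic_exponent_eq:
  assumes "power_polynomial g" "g \<noteq> 0" "z \<in> primitive_roots_of_unity n" "n \<ge> 1"
  shows "order z g = cyclotomic_exponent g n"
proof -
  let ?w = "cis (2 * pi / real n)"
  have w: "?w \<in> primitive_roots_of_unity n" using assms(4) by (rule primitive_root_cis)
  obtain i j where "i \<ge> 1" "?w = z ^ i" "j \<ge> 1" "z = ?w ^ j"
    using primitive_root_generates[OF assms(3,4), of ?w] primitive_root_generates[OF w assms(4), of z]
      primitive_root_power_eq_1_iff[OF assms(3,4), of n] primitive_root_power_eq_1_iff[OF w assms(4), of n]
    by (metis dvd_refl)
  then have "order z g \<le> order ?w g" "order ?w g \<le> order z g"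
    using power_polynomial_order_le[OF assms(1,2), of z i] power_polynomial_order_le[OF assms(1,2), of ?w j]
      primitive_root_nonzero[OF assms(3,4)] primitive_root_nonzero[OF w assms(4)] by auto
  then show ?thesis by (simp add: cyclotomic_exponent_def)
qed

lemma cyclotomic_exponent_antimono:
  assumes "power_polynomial g" "g \<noteq> 0" "m dvd n" "m \<ge> 1" "n \<ge> 1"
  shows "cyclotomic_exponent g n \<le> cyclotomic_exponent g m"
proof -
  let ?w = "cis (2 * pi / real n)"
  have w: "?w \<in> primitive_roots_of_unity n" using assms(5) by (rule primitive_root_cis)
  obtain i where i: "n = m * i" using assms(3) by auto
  with assms have "i \<ge> 1" by (cases i) auto
  have "?w ^ i = cis (2 * pi / real m)"
    using \<open>i \<ge> 1\<close> i by (simp add: DeMoivre)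
  then show ?thesis
    using power_polynomial_order_le[OF assms(1,2) primitive_root_nonzero[OF w assms(5)] \<open>i \<ge> 1\<close>]
    by (simp add: cyclotomic_exponent_def)
qed

lemma finite_cyclotomic_support:
  assumes "g \<noteq> 0"
  shows "finite {n. n \<ge> 1 \<and> cyclotomic_exponent g n \<noteq> 0}"
proof -
  let ?w = "\<lambda>n. cis (2 * pi / real n)"
  have "?w ` {n. n \<ge> 1 \<and> cyclotomic_exponent g n \<noteq> 0} \<subseteq> {z. poly g z = 0}"
    using assms by (auto simp: cyclotomic_exponent_def order_root)
  moreover have "inj_on ?w {n. n \<ge> 1 \<and> cyclotomic_exponent g n \<noteq> 0}"
  proof (rule inj_onI, clarify)
    fix m n :: nat
    assume *: "m \<ge> 1" "n \<ge> 1" and eq: "?w m = ?w n"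
    have "?w n ^ n = 1" "?w m ^ m = 1"
      using primitive_root_cis[of n] primitive_root_cis[of m] * by (auto simp: primitive_roots_of_unity_def)
    with eq have "m dvd n" "n dvd m"
      using primitive_root_power_eq_1_iff[OF primitive_root_cis, of m n]
        primitive_root_power_eq_1_iff[OF primitive_root_cis, of n m] * by auto
    then show "m = n" by (rule dvd_antisym)
  qed
  ultimately show ?thesis
    using poly_roots_finite[OF assms] by (meson finite_imageD finite_subset)
qed

lemma power_polynomial_order:
  assumes "power_polynomial g" "g \<noteq> 0" "z \<noteq> 0"
  obtains n where "n \<ge> 1" "z \<in> primitive_roots_of_unity n" "order z g = cyclotomic_exponent g n"
  | "\<And>m. m \<ge> 1 \<Longrightarrow> z ^ m \<noteq> 1" "order z g = 0"
proof (cases "\<exists>m\<ge>1. z ^ m = 1")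
  case True
  then obtain n where "n \<ge> 1" "z \<in> primitive_roots_of_unity n"
    using root_of_unity_is_primitive by metis
  with that(1) cyclotomic_exponent_eq[OF assms(1,2)] show ?thesis by blast
qed (use that(2) power_polynomial_root_of_unity[OF assms] in blast)

lemma primitive_roots_disjoint:
  assumes "z \<in> primitive_roots_of_unity m" "z \<in> primitive_roots_of_unity n" "m \<ge> 1" "n \<ge> 1"
  shows "m = n"
  using primitive_root_power_eq_1_iff[OF assms(1,3), of n] primitive_root_power_eq_1_iff[OF assms(2,4), of m]
    assms(1,2) by (intro dvd_antisym) (auto simp: primitive_roots_of_unity_def)

lemma cyclotomic_factorization:
  assumes "power_polynomial g" "g \<noteq> 0"
  defines "a \<equiv> cyclotomic_exponent g"
  shows "eq_up_to_unit (to_laurent1 g) (to_laurent1 (\<Prod>n\<in>{n. n \<ge> 1 \<and> a n \<noteq> 0}. cyclotomic n ^ a n))"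
proof (rule to_laurent1_eq_up_to_unit)
  let ?N = "{n. n \<ge> 1 \<and> a n \<noteq> 0}"
  have fin: "finite ?N" unfolding a_def by (rule finite_cyclotomic_support[OF assms(2)])
  have nz: "cyclotomic n \<noteq> 0" if "n \<ge> 1" for n
    using finite_primitive_roots[OF that] by (simp add: cyclotomic_def)
  then show "(\<Prod>n\<in>?N. cyclotomic n ^ a n) \<noteq> 0" using fin by simp
  fix z :: complex
  assume "z \<noteq> 0"
  have "order z (\<Prod>n\<in>?N. cyclotomic n ^ a n) = (\<Sum>n\<in>?N. order z (cyclotomic n ^ a n))"
    using nz by (intro order_prod) simp
  also have "\<dots> = (\<Sum>n\<in>?N. if z \<in> primitive_roots_of_unity n then a n else 0)"
    using nz by (intro sum.cong) (auto simp: order_power_eq order_cyclotomic)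
  also have "\<dots> = order z g"
    using assms(1,2) \<open>z \<noteq> 0\<close>
  proof (cases rule: power_polynomial_order)
    case (1 n)
    then have "(\<Sum>k\<in>?N. if z \<in> primitive_roots_of_unity k then a k else 0)
        = (\<Sum>k\<in>?N. if k = n then a k else 0)"
      using primitive_roots_disjoint by (intro sum.cong) auto
    also have "\<dots> = a n" using fin 1(1) by (simp add: sum.delta)
    finally show ?thesis using 1 by (simp add: a_def)
  next
    case 2
    then have "z \<notin> primitive_roots_of_unity k" if "k \<in> ?N" for k
      using that by (auto simp: primitive_roots_of_unity_def)
    with 2 show ?thesis by simp
  qed
  finally show "order z g = order z (\<Prod>n\<in>?N. cyclotomic n ^ a n)" by simp
qed (rule assms(2))

text \<open>
The multiplicity at a primitive \<open>n\<close>-th root of unity is the number of \<open>k \<ge> 1\<close> with \<open>k \<le> a\<^sub>n\<close>. Level by level,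
\<open>n\<close> lies in the divisor-closed set \<open>{n. a\<^sub>n \<ge> k}\<close> iff it divides a maximal element of that set, that is, iff
the psi-polynomial of the antichain of maximal elements vanishes there.
\<close>

lemma psi_factorization:
  assumes "power_polynomial g" "g \<noteq> 0"
  obtains ps where "\<And>p. p \<in> set ps \<Longrightarrow> psi_polynomial p"
    "eq_up_to_unit (to_laurent1 g) (to_laurent1 (prod_list ps))"
proof -
  let ?a = "cyclotomic_exponent g"
  let ?N = "{n. n \<ge> 1 \<and> ?a n \<noteq> 0}"
  have fin: "finite ?N" by (rule finite_cyclotomic_support[OF assms(2)])
  define A where "A k = {n. n \<ge> 1 \<and> ?a n \<ge> k \<and> (\<forall>m\<ge>1. n dvd m \<longrightarrow> ?a m \<ge> k \<longrightarrow> m = n)}" for k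
  have antichain: "finite_dvd_antichain (A k)" if "k \<ge> 1" for k
  proof -
    have "A k \<subseteq> ?N" using that by (auto simp: A_def)
    with fin have "finite (A k)" by (rule rev_finite_subset)
    then show ?thesis by (auto simp: finite_dvd_antichain_def A_def)
  qed
  have A_iff: "(\<exists>b\<in>A k. z ^ b = 1) \<longleftrightarrow> k \<le> ?a n"
    if "k \<ge> 1" "n \<ge> 1" and z: "z \<in> primitive_roots_of_unity n" for k n z
  proof
    assume "\<exists>b\<in>A k. z ^ b = 1"
    then obtain b where b: "b \<ge> 1" "?a b \<ge> k" "z ^ b = 1" by (auto simp: A_def)
    then have "n dvd b" using primitive_root_power_eq_1_iff[OF z that(2)] by simp
    with b that show "k \<le> ?a n"
      using cyclotomic_exponent_antimono[OF assms, of n b] by simp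
  next
    assume k: "k \<le> ?a n"
    let ?S = "{m. m \<ge> 1 \<and> n dvd m \<and> ?a m \<ge> k}"
    have "?S \<subseteq> ?N" using that by auto
    with fin have finS: "finite ?S" by (rule rev_finite_subset)
    have "n \<in> ?S" using k that by simp
    \<comment> \<open>A largest multiple of \<open>n\<close> in the level set is maximal there with respect to divisibility.\<close>
    define b where "b = Max ?S"
    have b: "b \<in> ?S" unfolding b_def using Max_in[OF finS] \<open>n \<in> ?S\<close> by (metis empty_iff)
    have "m = b" if "m \<ge> 1" "b dvd m" "?a m \<ge> k" for m
    proof -
      have "m \<in> ?S" using that b by (auto intro: dvd_trans)
      then have "m \<le> b" unfolding b_def using finS by simp
      moreover have "b \<le> m" using that by (intro dvd_imp_le) auto
      ultimately show ?thesis by simp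
    qed
    with b have "b \<in> A k" by (auto simp: A_def)
    moreover have "z ^ b = 1" using b primitive_root_power_eq_1_iff[OF z that(2)] by simp
    ultimately show "\<exists>b\<in>A k. z ^ b = 1" by blast
  qed
  obtain K where K: "?a n \<le> K" if "n \<ge> 1" for n
  proof
    show "?a n \<le> (\<Sum>n\<in>?N. ?a n)" if "n \<ge> 1" for n
      using that fin by (cases "?a n = 0") (auto intro: member_le_sum)
  qed
  define ps where "ps = map (\<lambda>k. psi (A k)) [1..<Suc K]"
  have nz: "0 \<notin> set ps"
    using psi_nonzero[OF antichain] by (auto simp: ps_def)
  show ?thesis
  proof
    show "psi_polynomial p" if "p \<in> set ps" for p
      using that antichain by (auto simp: ps_def psi_polynomial_def)
    show "eq_up_to_unit (to_laurent1 g) (to_laurent1 (prod_list ps))"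
    proof (rule to_laurent1_eq_up_to_unit)
      show "prod_list ps \<noteq> 0" using nz by (simp add: prod_list_zero_iff)
      fix z :: complex
      assume "z \<noteq> 0"
      have "order z (prod_list ps) = (\<Sum>k\<leftarrow>[1..<Suc K]. order z (psi (A k)))"
        using order_prod_list[OF nz] by (simp add: ps_def o_def)
      also have "\<dots> = (\<Sum>k = 1..K. order z (psi (A k)))"
        by (simp add: interv_sum_list_conv_sum_set_nat atLeastLessThanSuc_atLeastAtMost del: upt_Suc)
      also have "\<dots> = (\<Sum>k = 1..K. if \<exists>b\<in>A k. z ^ b = 1 then 1 else 0)"
        using order_psi[OF antichain \<open>z \<noteq> 0\<close>] by (intro sum.cong) auto
      also have "\<dots> = order z g"
        using assms \<open>z \<noteq> 0\<close>
      proof (cases rule: power_polynomial_order)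
        case (1 n)
        then have "(\<Sum>k = 1..K. if \<exists>b\<in>A k. z ^ b = 1 then 1 else 0) = (\<Sum>k = 1..K. if k \<le> ?a n then 1 else 0)"
          using A_iff by (intro sum.cong) auto
        also have "\<dots> = card ({1..K} \<inter> {k. k \<le> ?a n})"
          by (subst sum.If_cases) auto
        also have "{1..K} \<inter> {k. k \<le> ?a n} = {1..?a n}"
          using K[OF 1(1)] by auto
        finally show ?thesis using 1 by simp
      next
        case 2
        then have "\<not> (\<exists>b\<in>A k. z ^ b = 1)" for k
          by (auto simp: A_def)
        with 2 show ?thesis by simp
      qed
      finally show "order z g = order z (prod_list ps)" by simp
    qed (rule assms(2))
  qed
qed

section \<open>A term order\<close>

text \<open>
The lexicographic order along an enumeration of the coordinates: coordinate lists all have the same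
length, and on them the length-lexicographic order is a well-order.
\<close>

lemma exists_term_order: "\<exists>r :: (nat ^ 'd::finite) rel. term_order r"
proof -
  obtain xs :: "'d list" where xs: "set xs = UNIV"
    using finite_list[of "UNIV :: 'd set"] by auto
  define L :: "nat ^ 'd \<Rightarrow> nat list" where "L p = map (($) p) xs" for p
  let ?lt = "lenlex less_than"
  define r where "r = {(p, q). p = q \<or> (L p, L q) \<in> ?lt}"
  have inj: "p = q" if "L p = L q" for p q
    using that xs by (simp add: L_def vec_eq_iff)
  have trans: "(a, c) \<in> ?lt" if "(a, b) \<in> ?lt" "(b, c) \<in> ?lt" for a b c
    using that lenlex_transI[OF trans_less_than] by (blast dest: transD)
  have irrefl: "(a, a) \<notin> ?lt" for a
    by (rule lenlex_irreflexive) simp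
  have total: "(L p, L q) \<in> ?lt \<or> (L q, L p) \<in> ?lt" if "p \<noteq> q" for p q
    using that inj total_lenlex[OF total_less_than] by (auto simp: total_on_def)
  have lex: "(L p, L q) \<in> ?lt \<longleftrightarrow> (L p, L q) \<in> lex less_than" for p q
    by (simp add: lenlex_conv L_def)
  have L_add: "L (p + s) = map (\<lambda>i. p $ i + s $ i) xs" for p s
    by (simp add: L_def)
  have L_zero: "L 0 = map (\<lambda>i. 0) xs"
    by (simp add: L_def)
  have shift: "(map (\<lambda>i. f i + h i) ys, map (\<lambda>i. g i + h i) ys) \<in> lex less_than"
    if "(map f ys, map g ys) \<in> lex less_than" for f g h :: "'d \<Rightarrow> nat" and ys
    using that by (induction ys) auto
  have least: "(map f ys, map (\<lambda>_. 0) ys) \<notin> lex less_than" for f :: "'d \<Rightarrow> nat" and ys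
    by (induction ys) auto
  have "well_order_on UNIV r"
    unfolding well_order_on_def linear_order_on_def partial_order_on_def preorder_on_def
  proof (intro conjI)
    show "refl_on UNIV r" by (auto simp: refl_on_def r_def)
    show "trans r" by (auto simp: trans_def r_def intro: trans)
    show "antisym r" by (auto simp: antisym_def r_def dest: trans simp: irrefl)
    show "total_on UNIV r" using total by (auto simp: total_on_def r_def)
    have "wf (inv_image ?lt L)" by (intro wf_inv_image wf_lenlex wf_less_than)
    then show "wf (r - Id)" by (rule wf_subset) (auto simp: r_def)
  qed (auto simp: r_def)
  moreover have "(p + s, q + s) \<in> r" if "(p, q) \<in> r" for p q s
    using that shift[of "($) p" xs "($) q" "($) s"] by (auto simp: r_def lex L_add) (simp add: L_def)
  moreover have "(0, p) \<in> r" for p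
  proof (cases "p = 0")
    case False
    have "(L p, L 0) \<notin> ?lt"
      unfolding lex unfolding L_zero using least by (simp add: L_def)
    with total[of 0 p] False show ?thesis by (auto simp: r_def)
  qed (simp add: r_def)
  ultimately show ?thesis by (auto simp: term_order_def)
qed

section \<open>Primitive and positive exponents\<close>

definition pos_part :: "int ^ 'd \<Rightarrow> nat ^ 'd" where "pos_part v = (\<chi> i. nat (v $ i))"

text \<open>
The fraction \<open>x\<^sup>q/x\<^sup>p\<close> in lowest terms with exponent \<open>v = q - p\<close> has \<open>q = pos_part v\<close> and
\<open>p = pos_part (- v)\<close>.
\<close>

definition positive_exponent :: "(nat ^ 'd::finite) rel \<Rightarrow> int ^ 'd \<Rightarrow> bool" where
  "positive_exponent r v \<longleftrightarrow> v \<noteq> 0 \<and> (pos_part (- v), pos_part v) \<in> r"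

lemma pos_part_uminus_neq: "pos_part (- v) \<noteq> pos_part v" if "v \<noteq> 0"
proof
  assume "pos_part (- v) = pos_part v"
  then have "nat (- (v $ i)) = nat (v $ i)" for i
    by (simp add: pos_part_def vec_eq_iff)
  then have "v $ i = 0" for i by (metis linorder_le_cases nat_0_iff neg_0_le_iff_le nat_eq_iff2 minus_equation_iff antisym neg_le_0_iff_le)
  with that show False by (simp add: vec_eq_iff)
qed

lemma positive_exponent_cases:
  assumes "term_order r" "v \<noteq> 0"
  shows "positive_exponent r v \<or> positive_exponent r (- v)"
  using assms pos_part_uminus_neq[OF assms(2)]
  by (auto simp: positive_exponent_def term_order_def well_order_on_def linear_order_on_def total_on_def)

lemma positive_exponent_asym:
  assumes "term_order r" "positive_exponent r v"
  shows "\<not> positive_exponent r (- v)"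
proof
  assume "positive_exponent r (- v)"
  then have "(pos_part v, pos_part (- v)) \<in> r" by (simp add: positive_exponent_def)
  moreover have "(pos_part (- v), pos_part v) \<in> r" "v \<noteq> 0" using assms(2) by (auto simp: positive_exponent_def)
  moreover have "antisym r"
    using assms(1) by (simp add: term_order_def well_order_on_def linear_order_on_def partial_order_on_def)
  ultimately show False using pos_part_uminus_neq[of v] by (auto dest: antisymD)
qed

text \<open>
Coprimality of the coordinates in the form of a Bezout identity; the witness \<open>w\<close> splits \<open>v\<close> off as a
direct summand of the exponent group.
\<close>

definition primitive :: "int ^ 'd::finite \<Rightarrow> bool" where
  "primitive v \<longleftrightarrow> (\<exists>w. dot w v = 1)"

lemma primitive_nonzero: "primitive v \<Longrightarrow> v \<noteq> 0"
  by (auto simp: primitive_def)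

lemma primitive_uminus: "primitive (- v) \<longleftrightarrow> primitive v"
proof -
  have "primitive (- v)" if "primitive v" for v :: "int ^ 'd"
  proof -
    from that obtain w where "dot w v = 1" by (auto simp: primitive_def)
    then have "dot (- w) (- v) = 1" by (simp add: dot_def)
    then show ?thesis by (auto simp: primitive_def)
  qed
  from this[of v] this[of "- v"] show ?thesis by auto
qed

lemma positive_fraction_monomial:
  assumes "positive_exponent r v" "primitive v"
  shows "positive_fraction r (Poly_Mapping.single v 1)"
  unfolding positive_fraction_def
proof (intro exI conjI)
  let ?p = "pos_part (- v)" and ?q = "pos_part v"
  show "(?p, ?q) \<in> r" "?p \<noteq> ?q"
    using assms(1) pos_part_uminus_neq by (auto simp: positive_exponent_def)
  have v: "v $ i = int (?q $ i) - int (?p $ i)" for i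
    by (simp add: pos_part_def)
  then have "(\<chi> i. int (?q $ i) - int (?p $ i)) = v" by (simp add: vec_eq_iff)
  then show "Poly_Mapping.single v 1 = Poly_Mapping.single (\<chi> i. int (?q $ i) - int (?p $ i)) 1"
    by simp
  let ?D = "Gcd (range (($) ?p) \<union> range (($) ?q))"
  have "?D dvd ?p $ i" "?D dvd ?q $ i" for i by (auto intro: Gcd_dvd)
  then have "int ?D dvd v $ i" for i
    unfolding v by (intro dvd_diff) (simp_all only: int_dvd_int_iff)
  then have dvd: "int ?D dvd dot w v" for w by (auto simp: dot_def intro: dvd_sum)
  from assms(2) obtain w where "dot w v = 1" by (auto simp: primitive_def)
  with dvd[of w] have "?D = 1" by (metis int_dvd_int_iff nat_dvd_1_iff_1 of_nat_1)
  then show "primitive_pair ?p ?q"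
    by (auto simp: primitive_pair_def pos_part_def)
qed

lemma finite_bezout:
  assumes "finite S"
  shows "\<exists>w. (\<Sum>i\<in>S. w i * m i) = (Gcd (m ` S) :: int)"
  using assms
proof (induction S)
  case (insert x S)
  then obtain w where w: "(\<Sum>i\<in>S. w i * m i) = Gcd (m ` S)" by blast
  obtain a b where ab: "a * m x + b * Gcd (m ` S) = gcd (m x) (Gcd (m ` S))"
    using bezout_int by blast
  have "(\<Sum>i\<in>S. (if i = x then a else b * w i) * m i) = b * (\<Sum>i\<in>S. w i * m i)"
    unfolding sum_distrib_left using insert(2) by (intro sum.cong) (auto simp: mult.assoc)
  with w ab insert(1,2) have "(\<Sum>i\<in>insert x S. (if i = x then a else b * w i) * m i) = Gcd (m ` insert x S)"
    by simp
  then show ?case by (rule exI[of _ "\<lambda>i. if i = x then a else b * w i"])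
qed simp

lemma primitive_decomposition:
  fixes m :: "int ^ 'd::finite"
  assumes "m \<noteq> 0"
  obtains n v where "n \<ge> 1" "primitive v" "m = int n *s v"
proof -
  obtain w where w: "(\<Sum>i\<in>UNIV. w i * m $ i) = Gcd (range (($) m))"
    using finite_bezout[of "UNIV :: 'd set" "($) m"] by auto
  define g where "g = Gcd (range (($) m))"
  define v where "v = (\<chi> i. m $ i div g)"
  have "g \<noteq> 0" using assms by (auto simp: g_def Gcd_0_iff vec_eq_iff)
  moreover have "g \<ge> 0" by (simp add: g_def)
  ultimately have "g > 0" by simp
  have "g dvd m $ i" for i unfolding g_def by (intro Gcd_dvd) auto
  then have m: "m = g *s v" by (simp add: v_def vec_eq_iff)
  have "dot (\<chi> i. w i) m = g"
    using w by (simp add: dot_def g_def)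
  moreover have "dot (\<chi> i. w i) m = g * dot (\<chi> i. w i) v"
    by (subst m) (rule dot_scale)
  ultimately have "g * dot (\<chi> i. w i) v = g" by simp
  then have "dot (\<chi> i. w i) v = 1" using \<open>g > 0\<close> by simp
  then show ?thesis
    using \<open>g > 0\<close> m by (intro that[of "nat g" v]) (auto simp: primitive_def)
qed

text \<open>
A primitive vector generates the group of integer points on its line, so two primitive vectors on the
same line agree up to sign, and positivity fixes the sign.
\<close>

lemma primitive_not_proportional:
  assumes "term_order r" "primitive u" "primitive v" "positive_exponent r u" "positive_exponent r v"
    and "u \<noteq> v" "i \<ge> 1"
  shows "int i *s u \<noteq> n *s v"
proof
  assume eq: "int i *s u = n *s v"
  from assms(2,3) obtain w w' where w: "dot w v = 1" "dot w' u = 1" by (auto simp: primitive_def)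
  from eq have "int i * dot w' u = n * dot w' v" "int i * dot w u = n * dot w v"
    by (simp_all flip: dot_scale)
  with w have n: "int i = n * dot w' v" "n = int i * dot w u" by simp_all
  then have "int i * (dot w u * dot w' v) = int i * 1" by simp
  then have "dot w u * dot w' v = 1" using assms(7) by simp
  then have "dot w u = 1 \<or> dot w u = - 1" by (auto simp: zmult_eq_1_iff)
  with n(2) eq assms(7) have "u = v \<or> u = - v"
    by (auto simp: vec_eq_iff)
  with assms(6) positive_exponent_asym[OF assms(1,5)] assms(4) show False by auto
qed

section \<open>The prime elements \<open>x\<^sup>v - z\<close>\<close>

definition linear_factor :: "int ^ 'd::finite \<Rightarrow> complex \<Rightarrow> 'd laurent" where
  "linear_factor v z = Poly_Mapping.single v 1 - Poly_Mapping.single 0 z"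

lemma eval_at_linear: "eval_at [:- z, 1:] \<xi> = \<xi> - Poly_Mapping.single 0 z"
  by (simp add: eval_at_pCons single_uminus)

lemma eval_at_linear_factor: "eval_at [:- z, 1:] (Poly_Mapping.single v 1) = linear_factor v z"
  by (simp add: eval_at_linear linear_factor_def)

lemma linear_factor_nonzero: "v \<noteq> 0 \<Longrightarrow> linear_factor v z \<noteq> 0"
proof
  assume "v \<noteq> 0" "linear_factor v z = 0"
  then have "Poly_Mapping.lookup (linear_factor v z) v = 0" by simp
  with \<open>v \<noteq> 0\<close> show False by (simp add: linear_factor_def lookup_minus lookup_single)
qed

lemma eval_at_single_nonzero:
  fixes b :: "int ^ 'd::finite"
  assumes "b \<noteq> 0" "c \<noteq> 0" "p \<noteq> 0"
  shows "eval_at p (Poly_Mapping.single b c) \<noteq> 0"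
proof -
  let ?\<xi> = "Poly_Mapping.single b c"
  have lin: "eval_at [:- z, 1:] ?\<xi> \<noteq> 0" for z
  proof
    assume "eval_at [:- z, 1:] ?\<xi> = 0"
    then have "Poly_Mapping.lookup (eval_at [:- z, 1:] ?\<xi>) b = 0" by simp
    with assms show False by (simp add: eval_at_linear lookup_minus lookup_single)
  qed
  have prod: "eval_at (\<Prod>z\<in>#Z. [:- z, 1:]) ?\<xi> \<noteq> 0" for Z
  proof (induction Z)
    case (add z Z)
    then have "eval_at [:- z, 1:] ?\<xi> * eval_at (\<Prod>z\<in>#Z. [:- z, 1:]) ?\<xi> \<noteq> 0"
      using lin[of z] laurent_no_zero_divisors by blast
    then show ?case by (simp add: eval_at_mult del: mult_pCons_left)
  qed simp
  have "eval_at p ?\<xi> = Poly_Mapping.single 0 (lead_coeff p) * eval_at (\<Prod>z\<in>#proots p. [:- z, 1:]) ?\<xi>"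
    by (subst (1) complex_poly_decompose_multiset[symmetric]) (simp only: eval_at_smult)
  moreover have "Poly_Mapping.single (0 :: int ^ 'd) (lead_coeff p) \<noteq> 0"
    using assms(3) by (metis leading_coeff_0_iff lookup_single_eq lookup_zero)
  ultimately show ?thesis using prod laurent_no_zero_divisors by metis
qed

text \<open>
For \<open>dot w v = 1\<close>, the substitution \<open>x\<^sup>a \<mapsto> z\<^bsup>w \<bullet> a\<^esup> x\<^bsup>a - (w \<bullet> a) v\<^esup>\<close> is the retraction of the Laurent ring onto
the subring with exponents orthogonal to \<open>w\<close> that sets \<open>x\<^sup>v\<close> to \<open>z\<close>: a coordinate-free form of
\<open>x\<^sub>1 \<mapsto> z\<close>, with kernel generated by \<open>x\<^sup>v - z\<close>.
\<close>

locale primitive_direction =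
  fixes v w :: "int ^ 'd::finite" and z :: complex
  assumes dot_eq_1: "dot w v = 1" and z_nonzero: "z \<noteq> 0"
begin

sublocale twisted_substitution "\<lambda>a. z powi dot w a" "\<lambda>a. a - dot w a *s v"
  by unfold_locales (simp_all add: dot_add power_int_add z_nonzero vector_sadd_rdistrib)

lemma subst_linear_factor [simp]: "subst (linear_factor v z) = 0"
  by (simp add: linear_factor_def subst_diff subst_single dot_eq_1)

lemma linear_factor_dvd_power_diff:
  "linear_factor v z dvd Poly_Mapping.single (int k *s v) 1 - Poly_Mapping.single 0 (z ^ k)"
proof -
  have "linear_factor v z dvd Poly_Mapping.single v 1 ^ k - Poly_Mapping.single 0 z ^ k"
    unfolding linear_factor_def power_diff_sumr2 by simp
  then show ?thesis by (simp add: power_single)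
qed

text \<open>
On a monomial, \<open>x\<^sup>a\<close> and its image differ by a unit times \<open>(x\<^sup>v)\<^sup>n - z\<^sup>n\<close> with \<open>n = \<bar>dot w a\<bar>\<close>; if \<open>dot w a\<close>
is negative, the unit absorbs the negative powers.
\<close>

lemma linear_factor_dvd_diff_subst: "linear_factor v z dvd f - subst f"
proof (induction f rule: poly_mapping_induct_sum)
  case (single a c)
  let ?n = "dot w a"
  show ?case
  proof (cases "?n \<ge> 0")
    case True
    define k where "k = nat ?n"
    with True have n: "?n = int k" by simp
    have "Poly_Mapping.single a c - subst (Poly_Mapping.single a c) =
        Poly_Mapping.single (a - int k *s v) c * (Poly_Mapping.single (int k *s v) 1 - Poly_Mapping.single 0 (z ^ k))"
      by (simp add: subst_single n right_diff_distrib mult_single mult.commute)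
    then show ?thesis using linear_factor_dvd_power_diff by simp
  next
    case False
    define k where "k = nat (- ?n)"
    with False have n: "?n = - int k" by simp
    have shift: "a - - int k *s v = a + int k *s v" by (simp add: vec_eq_iff)
    have "Poly_Mapping.single a c - subst (Poly_Mapping.single a c) =
        - (Poly_Mapping.single a (c / z ^ k) * (Poly_Mapping.single (int k *s v) 1 - Poly_Mapping.single 0 (z ^ k)))"
      using z_nonzero
      by (simp add: subst_single n right_diff_distrib mult_single power_int_minus field_simps)
        (simp only: shift)
    then show ?thesis using linear_factor_dvd_power_diff by simp
  qed
next
  case (add f g)
  then show ?case unfolding subst_add add_diff_add by (rule dvd_add)
qed

lemma linear_factor_dvd_iff: "linear_factor v z dvd f \<longleftrightarrow> subst f = 0"
proof
  assume "linear_factor v z dvd f"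
  then have "subst (linear_factor v z) dvd subst f" by (rule subst_dvd)
  then show "subst f = 0" by simp
next
  assume "subst f = 0"
  with linear_factor_dvd_diff_subst[of f] show "linear_factor v z dvd f" by simp
qed

lemma linear_factor_prime:
  "linear_factor v z dvd f * g \<longleftrightarrow> linear_factor v z dvd f \<or> linear_factor v z dvd g"
  using laurent_no_zero_divisors by (auto simp: linear_factor_dvd_iff subst_mult)

lemma linear_factor_dvd_eval_at_iff:
  "linear_factor v z dvd eval_at p (Poly_Mapping.single v 1) \<longleftrightarrow> poly p z = 0"
proof -
  have "subst (eval_at p (Poly_Mapping.single v 1)) = Poly_Mapping.single 0 (poly p z)"
    by (simp add: subst_eval_at subst_single dot_eq_1 eval_at_single_0)
  then show ?thesis
    by (metis linear_factor_dvd_iff lookup_single_eq lookup_zero single_zero)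
qed

text \<open>
The monomial \<open>x\<^sup>u\<close> reduces to a scalar times \<open>x\<^bsup>u - (w \<bullet> u) v\<^esup>\<close>, which is not constant, as \<open>u\<close> is
not a multiple of \<open>v\<close>, and hence transcendental over \<open>\<complex>\<close>.
\<close>

lemma not_linear_factor_dvd_eval_at:
  assumes "\<And>n. u \<noteq> n *s v" "p \<noteq> 0"
  shows "\<not> linear_factor v z dvd eval_at p (Poly_Mapping.single u 1)"
  unfolding linear_factor_dvd_iff subst_eval_at subst_single
  using assms z_nonzero by (intro eval_at_single_nonzero) auto

end

lemma primitive_directionI:
  assumes "primitive v" "z \<noteq> 0"
  obtains w where "primitive_direction v w z"
  using assms by (auto simp: primitive_def primitive_direction_def)

section \<open>Elimination of the coefficients\<close>

interpretation power: twisted_substitution "\<lambda>_. 1" "\<lambda>a :: int ^ 'd::finite. int i *s a" for i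
  by unfold_locales (simp_all add: vector_add_ldistrib)

lemma power_subst_eq: "power_subst i f = power.subst i f"
  by (simp add: power_subst_def power.subst_def)

lemma power_subst_eval_at:
  "power_subst i (eval_at p (Poly_Mapping.single v 1)) = eval_at (pcompose p (monom 1 i)) (Poly_Mapping.single v 1)"
  by (simp add: power_subst_eq power.subst_eval_at power.subst_single eval_at_pcompose eval_at_monom power_single)

text \<open>
The equations \<open>f\<^sup>(\<^sup>i\<^sup>) = \<Sum>\<^sub>b c\<^sub>b (x\<^sup>b)\<^sup>i\<close> form a Vandermonde system for the \<open>c\<^sub>b\<close> with nodes \<open>x\<^sup>b\<close>. Combining them
with the coefficients of a polynomial that vanishes at \<open>0\<close> and at all nodes but \<open>x\<^sup>a\<close> isolates \<open>c\<^sub>a\<close>;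
the factor \<open>t\<close> keeps \<open>f\<^sup>(\<^sup>0\<^sup>)\<close>, which \<open>f\<close> need not divide, out of the combination.
\<close>

lemma dvd_power_substs_imp_dvd_prod_diff:
  fixes f :: "'d::finite laurent"
  assumes dvd: "\<And>i. i \<ge> 1 \<Longrightarrow> f dvd power_subst i f" and a: "a \<in> Poly_Mapping.keys f"
  shows "f dvd (\<Prod>b\<in>Poly_Mapping.keys f - {a}. Poly_Mapping.single a 1 - Poly_Mapping.single b 1)"
proof -
  let ?K = "Poly_Mapping.keys f"
  let ?x = "\<lambda>a :: int ^ 'd. Poly_Mapping.single a (1 :: complex)"
  let ?c = "\<lambda>a. Poly_Mapping.single 0 (Poly_Mapping.lookup f a) :: 'd laurent"
  \<comment> \<open>A polynomial over the Laurent ring, to be evaluated at monomials.\<close>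
  define P where "P = [:0, 1:] * (\<Prod>b\<in>?K - {a}. [:- ?x b, 1:])"
  have P: "poly P y = y * (\<Prod>b\<in>?K - {a}. y - ?x b)" for y
    by (simp add: P_def poly_prod)
  have power_sum: "(\<Sum>b\<in>?K. ?c b * ?x b ^ i) = power_subst i f" for i
    by (simp add: power_subst_def power_single mult_single)
  have "(\<Sum>b\<in>?K. ?c b * poly P (?x b)) = (\<Sum>b\<in>?K. \<Sum>i\<le>degree P. coeff P i * (?c b * ?x b ^ i))"
    by (simp add: poly_altdef sum_distrib_left mult.left_commute)
  also have "\<dots> = (\<Sum>i\<le>degree P. coeff P i * power_subst i f)"
    by (subst sum.swap) (simp flip: power_sum sum_distrib_left)
  also have "f dvd \<dots>"
  proof (rule dvd_sum)
    fix i
    show "f dvd coeff P i * power_subst i f"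
    proof (cases "i = 0")
      case True
      have "coeff P 0 = 0" by (simp add: P_def)
      with True show ?thesis by simp
    qed (simp add: dvd)
  qed
  finally have "f dvd (\<Sum>b\<in>?K. ?c b * poly P (?x b))" .
  also have "(\<Sum>b\<in>?K. ?c b * poly P (?x b)) = ?c a * poly P (?x a)"
  proof -
    have "poly P (?x b) = 0" if "b \<in> ?K - {a}" for b
    proof -
      have "(\<Prod>c\<in>?K - {a}. ?x b - ?x c) = 0"
        using that by (intro prod_zero) auto
      then show ?thesis by (simp add: P)
    qed
    then show ?thesis using a by (subst sum.remove[of _ a]) auto
  qed
  also have "\<dots> = Poly_Mapping.single a (Poly_Mapping.lookup f a) * (\<Prod>b\<in>?K - {a}. ?x a - ?x b)"
    by (simp add: P mult_single flip: mult.assoc)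
  finally have "f dvd Poly_Mapping.single a (Poly_Mapping.lookup f a) * (\<Prod>b\<in>?K - {a}. ?x a - ?x b)" .
  moreover have "Poly_Mapping.single a (Poly_Mapping.lookup f a) dvd 1"
    using a by (intro single_unit) (simp add: in_keys_iff)
  ultimately show ?thesis by (rule dvd_unit_cancel[rotated])
qed

section \<open>Factorization into linear factors\<close>

text \<open>
By induction on the product: a prime factor divides \<open>f\<close> or the complementary divisor, and it is
cancelled from whichever it divides.
\<close>

lemma dvd_prod_primes:
  fixes f :: "'d::finite laurent"
  assumes prime: "\<And>x g h. x \<in># M \<Longrightarrow> \<pi> x dvd g * h \<Longrightarrow> \<pi> x dvd g \<or> \<pi> x dvd h"
    and nonzero: "\<And>x. x \<in># M \<Longrightarrow> \<pi> x \<noteq> 0"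
    and "f dvd (\<Prod>x\<in>#M. \<pi> x)"
  shows "\<exists>N. N \<subseteq># M \<and> eq_up_to_unit f (\<Prod>x\<in>#N. \<pi> x)"
  using assms
proof (induction M arbitrary: f)
  case empty
  then show ?case by (auto simp: eq_up_to_unit_def)
next
  case (add x M)
  let ?P = "\<Prod>x\<in>#M. \<pi> x"
  have IH: "\<exists>N. N \<subseteq># M \<and> eq_up_to_unit f (\<Prod>x\<in>#N. \<pi> x)" if "f dvd ?P" for f
  proof (rule add.IH[OF _ _ that])
    show "\<pi> x dvd g \<or> \<pi> x dvd h" if "x \<in># M" "\<pi> x dvd g * h" for x g h
      using that add.prems(1)[of x g h] by simp
    show "\<pi> x \<noteq> 0" if "x \<in># M" for x
      using that add.prems(2)[of x] by simp
  qed
  from add.prems(3) obtain k where k: "\<pi> x * ?P = f * k" by (auto simp: dvd_def)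
  then have "\<pi> x dvd f * k" by (metis dvd_triv_left)
  then consider "\<pi> x dvd f" | "\<pi> x dvd k" using add.prems(1)[of x] by auto
  then show ?case
  proof cases
    case 1
    then obtain f' where f': "f = \<pi> x * f'" ..
    with k have "\<pi> x * ?P = \<pi> x * (f' * k)" by (simp add: mult.assoc)
    then have "?P = f' * k" using add.prems(2)[of x] laurent_mult_left_cancel by auto
    with IH[of f'] obtain N u where "N \<subseteq># M" "u dvd 1" "f' = u * (\<Prod>x\<in>#N. \<pi> x)"
      by (auto simp: eq_up_to_unit_def)
    then have "add_mset x N \<subseteq># add_mset x M" "f = u * (\<Prod>x\<in>#add_mset x N. \<pi> x)"
      using f' by (simp_all add: mult.left_commute)
    with \<open>u dvd 1\<close> show ?thesis unfolding eq_up_to_unit_def by blast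
  next
    case 2
    then obtain k' where "k = \<pi> x * k'" ..
    with k have "\<pi> x * ?P = \<pi> x * (f * k')" by (simp add: mult.left_commute)
    then have "?P = f * k'" using add.prems(2)[of x] laurent_mult_left_cancel by auto
    with IH[of f] obtain N where "N \<subseteq># M" "eq_up_to_unit f (\<Prod>x\<in>#N. \<pi> x)" by auto
    moreover have "N \<subseteq># add_mset x M"
      using \<open>N \<subseteq># M\<close> by (simp add: subseteq_mset_def le_SucI)
    ultimately show ?thesis by blast
  qed
qed

abbreviation factor_data :: "(nat ^ 'd::finite) rel \<Rightarrow> ((int ^ 'd) \<times> complex) set" where
  "factor_data r \<equiv> {(v, z). primitive v \<and> positive_exponent r v \<and> z \<noteq> 0}"

text \<open>
With \<open>a - b = n v\<close> the binomial is \<open>x\<^sup>b (x\<^sup>n\<^sup>v - 1)\<close>, and \<open>t\<^sup>n - 1\<close> splits over \<open>\<complex>\<close>. If \<open>v\<close> is not positive, the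
roles of \<open>a\<close> and \<open>b\<close> are exchanged.
\<close>

lemma binomial_dvd_linear_factors:
  fixes a b :: "int ^ 'd::finite"
  assumes "term_order r" "a \<noteq> b"
  shows "\<exists>M. set_mset M \<subseteq> factor_data r \<and>
    Poly_Mapping.single a 1 - Poly_Mapping.single b 1 dvd (\<Prod>(v, z)\<in>#M. linear_factor v z)"
proof -
  have *: "\<exists>M. set_mset M \<subseteq> factor_data r \<and>
      Poly_Mapping.single a 1 - Poly_Mapping.single b 1 dvd (\<Prod>(v, z)\<in>#M. linear_factor v z)"
    if pos: "positive_exponent r v" and prim: "primitive v" and n: "n \<ge> 1" and ab: "a - b = int n *s v"
    for a b v :: "int ^ 'd" and n :: nat
  proof -
    let ?p = "monom 1 n - [:1:] :: complex poly"
    have "coeff ?p n = 1" using n by (cases n) auto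
    moreover have "degree ?p \<le> n" by (intro degree_diff_le degree_monom_le) simp
    then have "degree ?p = n" using \<open>coeff ?p n = 1\<close> by (intro antisym le_degree) simp_all
    ultimately have "lead_coeff ?p = 1" by simp
    then have p: "(\<Prod>z\<in>#proots ?p. [:- z, 1:]) = ?p"
      using complex_poly_decompose_multiset[of ?p] by simp
    let ?M = "image_mset (Pair v) (proots ?p)"
    have "(\<Prod>(v, z)\<in>#?M. linear_factor v z) = eval_at ?p (Poly_Mapping.single v 1)"
      by (subst p[symmetric]) (simp add: eval_at_prod_mset eval_at_linear_factor image_mset.compositionality o_def)
    also have "\<dots> = Poly_Mapping.single (a - b) 1 - 1"
      by (simp add: eval_at_diff eval_at_monom power_single ab eval_at_const)
    also have "Poly_Mapping.single b 1 * (Poly_Mapping.single (a - b) 1 - 1) = Poly_Mapping.single a 1 - Poly_Mapping.single b (1 :: complex)"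
      by (simp add: right_diff_distrib mult_single)
    finally have "Poly_Mapping.single a 1 - Poly_Mapping.single b 1 dvd Poly_Mapping.single b 1 * (\<Prod>(v, z)\<in>#?M. linear_factor v z)"
      by simp
    then have "Poly_Mapping.single a 1 - Poly_Mapping.single b 1 dvd (\<Prod>(v, z)\<in>#?M. linear_factor v z)"
      by (rule dvd_unit_cancel[OF single_unit, rotated]) simp
    moreover have "z \<noteq> 0" if "z \<in># proots ?p" for z
    proof
      assume "z = 0"
      have "?p \<noteq> 0" using n by (rule monom_minus_const_nonzero)
      with that \<open>z = 0\<close> n show False by (simp add: poly_monom power_0_left)
    qed
    ultimately show ?thesis using pos prim by (intro exI[of _ ?M]) auto
  qed
  obtain n v where nv: "n \<ge> 1" "primitive v" "a - b = int n *s v"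
    using primitive_decomposition[of "a - b"] assms(2) by auto
  consider "positive_exponent r v" | "positive_exponent r (- v)"
    using positive_exponent_cases[OF assms(1) primitive_nonzero[OF nv(2)]] by blast
  then show ?thesis
  proof cases
    case 1
    with nv show ?thesis by (intro *[of v n]) auto
  next
    case 2
    have "b - a = - (a - b)" by simp
    also have "\<dots> = int n *s (- v)" unfolding nv(3) by (simp add: vec_eq_iff)
    finally have "b - a = int n *s (- v)" .
    with 2 nv have "\<exists>M. set_mset M \<subseteq> factor_data r \<and>
      Poly_Mapping.single b 1 - Poly_Mapping.single a 1 dvd (\<Prod>(v, z)\<in>#M. linear_factor v z)"
      by (intro *[of "- v" n]) (auto simp: primitive_uminus)
    then show ?thesis
      unfolding minus_dvd_iff[of "Poly_Mapping.single b 1 - Poly_Mapping.single a 1", unfolded minus_diff_eq] .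
  qed
qed

lemma linear_factorization:
  fixes f :: "'d::finite laurent"
  assumes r: "term_order r" and "f \<noteq> 0" and dvd: "\<And>i. i \<ge> 1 \<Longrightarrow> f dvd power_subst i f"
  obtains M where "set_mset M \<subseteq> factor_data r" "eq_up_to_unit f (\<Prod>(v, z)\<in>#M. linear_factor v z)"
proof -
  obtain a where a: "a \<in> Poly_Mapping.keys f" using \<open>f \<noteq> 0\<close> keys_eq_empty by blast
  have "\<forall>b\<in>Poly_Mapping.keys f - {a}. \<exists>M. set_mset M \<subseteq> factor_data r \<and>
    Poly_Mapping.single a 1 - Poly_Mapping.single b 1 dvd (\<Prod>(v, z)\<in>#M. linear_factor v z)"
    by (intro ballI binomial_dvd_linear_factors[OF r]) auto
  from bchoice[OF this] obtain M where M: "\<forall>b\<in>Poly_Mapping.keys f - {a}. set_mset (M b) \<subseteq> factor_data r \<and>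
    Poly_Mapping.single a 1 - Poly_Mapping.single b 1 dvd (\<Prod>(v, z)\<in>#M b. linear_factor v z)" ..
  let ?M = "\<Sum>b\<in>Poly_Mapping.keys f - {a}. M b"
  have sub: "set_mset ?M \<subseteq> factor_data r" using M by (auto simp: set_mset_sum)
  have "f dvd (\<Prod>b\<in>Poly_Mapping.keys f - {a}. Poly_Mapping.single a 1 - Poly_Mapping.single b 1)"
    using dvd a by (rule dvd_power_substs_imp_dvd_prod_diff)
  also have "\<dots> dvd (\<Prod>b\<in>Poly_Mapping.keys f - {a}. \<Prod>(v, z)\<in>#M b. linear_factor v z)"
    using M by (intro prod_dvd_prod) blast
  also have "(\<Prod>b\<in>S. \<Prod>(v, z)\<in>#M b. linear_factor v z) = (\<Prod>(v, z)\<in>#(\<Sum>b\<in>S. M b). linear_factor v z)" if "finite S" for S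
    using that by (induction S) auto
  finally have "f dvd (\<Prod>(v, z)\<in>#?M. linear_factor v z)" by simp
  then have "\<exists>N. N \<subseteq># ?M \<and> eq_up_to_unit f (\<Prod>(v, z)\<in>#N. linear_factor v z)"
  proof (rule dvd_prod_primes[rotated 2])
    fix x g h
    assume x: "x \<in># ?M"
    then obtain v z where vz: "x = (v, z)" "primitive v" "z \<noteq> 0" using sub by (cases x) auto
    obtain w where "primitive_direction v w z" using primitive_directionI[OF vz(2,3)] .
    then interpret primitive_direction v w z .
    show "(case x of (v, z) \<Rightarrow> linear_factor v z) \<noteq> 0"
      using vz primitive_nonzero linear_factor_nonzero by auto
    assume "(case x of (v, z) \<Rightarrow> linear_factor v z) dvd g * h"
    then show "(case x of (v, z) \<Rightarrow> linear_factor v z) dvd g \<or> (case x of (v, z) \<Rightarrow> linear_factor v z) dvd h"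
      using vz by (simp add: linear_factor_prime)
  qed
  then show ?thesis using that sub by (meson order_trans set_mset_mono)
qed

section \<open>The polynomial attached to an exponent\<close>

text \<open>
Descends divisibility from \<open>h(x\<^sup>v)\<close> to \<open>h\<close>, in the presence of a cofactor \<open>B\<close>. Each prime \<open>x\<^sup>v - z\<close> has to
divide \<open>h(x\<^sup>v)\<close>, which means \<open>h(z) = 0\<close>; then \<open>x - z\<close> is split off from \<open>h\<close> and both sides are cancelled.
\<close>

lemma prod_linear_factors_dvd_imp_poly_dvd:
  fixes v :: "int ^ 'd::finite"
  assumes "primitive v" and "\<And>z. z \<in># Z \<Longrightarrow> z \<noteq> 0 \<and> \<not> linear_factor v z dvd B"
    and "(\<Prod>z\<in>#Z. linear_factor v z) dvd eval_at h (Poly_Mapping.single v 1) * B"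
  shows "(\<Prod>z\<in>#Z. [:- z, 1:]) dvd h"
  using assms
proof (induction Z arbitrary: h)
  case (add z Z)
  let ?x = "Poly_Mapping.single v 1 :: 'd laurent"
  let ?P = "\<Prod>z\<in>#Z. linear_factor v z"
  have z: "z \<noteq> 0" "\<not> linear_factor v z dvd B" using add.prems(2)[of z] by auto
  obtain w where "primitive_direction v w z" using primitive_directionI[OF add.prems(1) z(1)] .
  then interpret primitive_direction v w z .
  have dvd: "linear_factor v z * ?P dvd eval_at h ?x * B" using add.prems(3) by simp
  then have "linear_factor v z dvd eval_at h ?x * B" by (rule dvd_mult_left)
  then have "poly h z = 0" using z by (simp add: linear_factor_prime linear_factor_dvd_eval_at_iff)
  then obtain h' where h': "h = [:- z, 1:] * h'" by (auto simp: poly_eq_0_iff_dvd)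
  from dvd obtain k where "eval_at h ?x * B = linear_factor v z * ?P * k" ..
  then have "linear_factor v z * (eval_at h' ?x * B) = linear_factor v z * (?P * k)"
    unfolding h' eval_at_mult eval_at_linear_factor by (simp add: mult.assoc)
  then have "eval_at h' ?x * B = ?P * k"
    using linear_factor_nonzero[OF primitive_nonzero[OF add.prems(1)]] by (rule laurent_mult_left_cancel)
  then have "?P dvd eval_at h' ?x * B" by simp
  with add have "(\<Prod>z\<in>#Z. [:- z, 1:]) dvd h'" by auto
  then have "[:- z, 1:] * (\<Prod>z\<in>#Z. [:- z, 1:]) dvd h"
    unfolding h' by (rule mult_dvd_mono[OF dvd_refl])
  then show ?case by simp
qed simp

lemma prod_mset_fibres:
  fixes F :: "'a \<times> 'b \<Rightarrow> 'c::comm_monoid_mult"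
  assumes "finite V" "fst ` set_mset M \<subseteq> V"
  shows "(\<Prod>v\<in>V. \<Prod>x\<in>#filter_mset (\<lambda>x. fst x = v) M. F x) = (\<Prod>x\<in>#M. F x)"
  using assms(2)
proof (induction M)
  case (add x M)
  have "(\<Prod>v\<in>V. \<Prod>y\<in>#filter_mset (\<lambda>y. fst y = v) (add_mset x M). F y)
      = (\<Prod>v\<in>V. (if v = fst x then F x else 1) * (\<Prod>y\<in>#filter_mset (\<lambda>y. fst y = v) M. F y))"
    by (intro prod.cong) auto
  also have "\<dots> = F x * (\<Prod>x\<in>#M. F x)"
    using add assms(1) by (simp add: prod.distrib)
  finally show ?case by simp
qed simp

section \<open>Power-closed principal ideals\<close>

lemma power_closed_principal_iff:
  "power_closed_ideal (ideal.span {f}) \<longleftrightarrow> (\<forall>i\<ge>1. f dvd power_subst i f)"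
proof -
  have span: "h \<in> ideal.span {f} \<longleftrightarrow> f dvd h" for h
    by (auto simp: ideal.span_singleton dvd_def mult.commute)
  have "f dvd power_subst i h" if "f dvd power_subst i f" "f dvd h" for i h
    using that power.subst_dvd[of f h i] by (auto simp: power_subst_eq intro: dvd_trans)
  then show ?thesis
    by (auto simp: power_closed_ideal_def span ideal.subspace_span)
qed

lemma product_dvd_power_subst:
  assumes "eq_up_to_unit f (\<Prod>j\<in>J. eval_at (g j) (Poly_Mapping.single (v j) 1))"
    and "\<And>j. j \<in> J \<Longrightarrow> power_polynomial (g j)" "i \<ge> 1"
  shows "f dvd power_subst i f"
proof -
  let ?P = "\<Prod>j\<in>J. eval_at (g j) (Poly_Mapping.single (v j) 1)"
  from assms(1) obtain u where u: "u dvd 1" "f = u * ?P" by (auto simp: eq_up_to_unit_def)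
  have "?P dvd (\<Prod>j\<in>J. eval_at (pcompose (g j) (monom 1 i)) (Poly_Mapping.single (v j) 1))"
    using assms(2,3) by (intro prod_dvd_prod eval_at_dvd) (auto simp: power_polynomial_def)
  also have "\<dots> = power_subst i ?P"
    by (simp add: power_subst_eq power.subst_prod flip: power_subst_eval_at)
  also have "\<dots> dvd power_subst i f"
    by (simp add: u(2) power_subst_eq power.subst_mult)
  finally have "?P dvd power_subst i f" .
  moreover have "f dvd ?P" by (rule dvd_unit_cancel[OF u(1)]) (simp add: u(2))
  ultimately show ?thesis by (rule dvd_trans[rotated])
qed

text \<open>
The polynomial \<open>g v\<close> collects the linear factors of \<open>f\<close> with exponent \<open>v\<close>. When \<open>f\<close> divides \<open>f\<^sup>(\<^sup>i\<^sup>)\<close>,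
the factors of \<open>f\<^sup>(\<^sup>i\<^sup>)\<close> belonging to the other exponents are coprime to those of \<open>v\<close> and can be discarded.
\<close>

lemma power_dvd_imp_product:
  fixes f :: "'d::finite laurent"
  assumes r: "term_order r" and "f \<noteq> 0" and dvd: "\<And>i. i \<ge> 1 \<Longrightarrow> f dvd power_subst i f"
  shows "\<exists>V g. finite V \<and>
    (\<forall>v\<in>V. primitive v \<and> positive_exponent r v \<and> g v \<noteq> 0 \<and> power_polynomial (g v)) \<and>
    eq_up_to_unit f (\<Prod>v\<in>V. eval_at (g v) (Poly_Mapping.single v 1))"
proof -
  obtain M where M: "set_mset M \<subseteq> factor_data r" "eq_up_to_unit f (\<Prod>(v, z)\<in>#M. linear_factor v z)"
    using linear_factorization[OF assms] .
  let ?x = "\<lambda>v. Poly_Mapping.single v 1 :: 'd laurent"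
  define V where "V = fst ` set_mset M"
  define Z where "Z v = image_mset snd (filter_mset (\<lambda>x. fst x = v) M)" for v
  define g where "g v = (\<Prod>z\<in>#Z v. [:- z, 1:])" for v
  have "finite V" by (simp add: V_def)
  have V: "primitive v \<and> positive_exponent r v" if "v \<in> V" for v
    using that M(1) by (auto simp: V_def)
  have Z: "z \<noteq> 0" if "z \<in># Z v" for z v
    using that M(1) by (auto simp: Z_def)
  have g_nonzero: "g v \<noteq> 0" for v by (auto simp: g_def)
  have g_eval: "eval_at (g v) (?x v) = (\<Prod>z\<in>#Z v. linear_factor v z)" for v
    by (simp add: g_def eval_at_prod_mset eval_at_linear_factor image_mset.compositionality o_def)
  also have "\<dots> v = (\<Prod>x\<in>#filter_mset (\<lambda>x. fst x = v) M. case x of (v, z) \<Rightarrow> linear_factor v z)" for v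
    unfolding Z_def image_mset.compositionality
    by (intro arg_cong[of _ _ prod_mset] image_mset_cong) auto
  finally have "(\<Prod>v\<in>V. eval_at (g v) (?x v)) = (\<Prod>(v, z)\<in>#M. linear_factor v z)"
    using prod_mset_fibres[OF \<open>finite V\<close>, of M "\<lambda>(v, z). linear_factor v z"] by (simp add: V_def)
  with M(2) have f: "eq_up_to_unit f (\<Prod>v\<in>V. eval_at (g v) (?x v))" by simp
  then obtain u where u: "u dvd 1" "f = u * (\<Prod>v\<in>V. eval_at (g v) (?x v))"
    by (auto simp: eq_up_to_unit_def)
  have "g v dvd pcompose (g v) (monom 1 i)" if "v \<in> V" "i \<ge> 1" for v i
  proof -
    \<comment> \<open>The cofactor, which has no prime in common with the part of the product belonging to \<open>v\<close>.\<close>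
    let ?B = "\<Prod>u\<in>V - {v}. eval_at (g u) (?x (int i *s u))"
    have "eval_at (g v) (?x v) dvd (\<Prod>v\<in>V. eval_at (g v) (?x v))"
      using \<open>finite V\<close> that(1) by (rule dvd_prodI)
    also have "\<dots> dvd f" by (simp add: u(2))
    also have "f dvd power_subst i f" using that(2) by (rule dvd)
    also have "power_subst i f = power_subst i u * (\<Prod>v\<in>V. eval_at (g v) (?x (int i *s v)))"
      unfolding u(2)
      by (simp only: power_subst_eq power.subst_mult power.subst_prod power.subst_eval_at power.subst_single mult_1)
    finally have "eval_at (g v) (?x v) dvd power_subst i u * (\<Prod>v\<in>V. eval_at (g v) (?x (int i *s v)))" .
    moreover have "power_subst i u dvd 1"
      using power.subst_dvd[OF u(1), of i] by (simp add: power_subst_eq)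
    ultimately have "eval_at (g v) (?x v) dvd (\<Prod>v\<in>V. eval_at (g v) (?x (int i *s v)))"
      by (rule dvd_unit_cancel[rotated])
    also have "\<dots> = eval_at (g v) (?x (int i *s v)) * ?B"
      using \<open>finite V\<close> that(1) by (rule prod.remove)
    also have "eval_at (g v) (?x (int i *s v)) = eval_at (pcompose (g v) (monom 1 i)) (?x v)"
      by (simp add: eval_at_pcompose eval_at_monom power_single)
    finally have "(\<Prod>z\<in>#Z v. linear_factor v z) dvd eval_at (pcompose (g v) (monom 1 i)) (?x v) * ?B"
      by (simp add: g_eval)
    then show ?thesis
      unfolding g_def[of v]
    proof (rule prod_linear_factors_dvd_imp_poly_dvd[rotated 2])
      show "primitive v" using V that(1) by blast
      fix z assume z: "z \<in># Z v"
      obtain w where "primitive_direction v w z"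
        using primitive_directionI[OF \<open>primitive v\<close> Z[OF z]] .
      then interpret primitive_direction v w z .
      have "\<not> linear_factor v z dvd (\<Prod>u\<in>S. eval_at (g u) (?x (int i *s u)))" if "S \<subseteq> V - {v}" for S
        using finite_subset[OF that finite_Diff[OF \<open>finite V\<close>]] that
      proof (induction S)
        case empty
        then show ?case by (simp add: linear_factor_dvd_iff)
      next
        case (insert u S)
        have "int i *s u \<noteq> n *s v" for n
          using insert.prems V \<open>v \<in> V\<close> \<open>i \<ge> 1\<close> by (intro primitive_not_proportional[OF r]) auto
        then have "\<not> linear_factor v z dvd eval_at (g u) (?x (int i *s u))"
          using g_nonzero by (rule not_linear_factor_dvd_eval_at)
        with insert show ?case by (simp add: linear_factor_prime)
      qed
      then show "z \<noteq> 0 \<and> \<not> linear_factor v z dvd ?B" using Z[OF z] by blast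
    qed
  qed
  then have "power_polynomial (g v)" if "v \<in> V" for v
    using that by (simp add: power_polynomial_def)
  with \<open>finite V\<close> V g_nonzero f show ?thesis by (intro exI[of _ V] exI[of _ g]) simp
qed

theorem theorem6p7:
  fixes f :: "'d::finite laurent"
  assumes "f \<noteq> 0"
  shows "(power_closed_ideal (ideal.span {f}) \<longleftrightarrow>
           (\<exists>(r :: (nat ^ 'd) rel) (k :: nat) (\<xi> :: nat \<Rightarrow> 'd laurent) (g :: nat \<Rightarrow> complex poly).
              term_order r \<and>
              inj_on \<xi> {1..k} \<and>
              (\<forall>i\<in>{1..k}. positive_fraction r (\<xi> i) \<and> g i \<noteq> 0 \<and> power_polynomial (g i)) \<and>
              eq_up_to_unit f (\<Prod>i=1..k. eval_at (g i) (\<xi> i))))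
       \<and> (\<forall>g :: complex poly. g \<noteq> 0 \<and> power_polynomial g \<longrightarrow>
           (\<exists>a :: nat \<Rightarrow> nat.
              finite {n. n \<ge> 1 \<and> a n \<noteq> 0} \<and>
              (\<forall>m n. m \<ge> 1 \<and> n \<ge> 1 \<and> m dvd n \<longrightarrow> a m \<ge> a n) \<and>
              eq_up_to_unit (to_laurent1 g)
                (to_laurent1 (\<Prod>n\<in>{n. n \<ge> 1 \<and> a n \<noteq> 0}. cyclotomic n ^ a n))) \<and>
           (\<exists>ps :: complex poly list.
              (\<forall>p\<in>set ps. psi_polynomial p) \<and>
              eq_up_to_unit (to_laurent1 g) (to_laurent1 (prod_list ps))))"
    (is "(?L \<longleftrightarrow> ?R) \<and> ?U")
proof (intro conjI iffI)
  assume ?L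
  then have dvd: "f dvd power_subst i f" if "i \<ge> 1" for i
    using that by (simp add: power_closed_principal_iff)
  obtain r :: "(nat ^ 'd) rel" where r: "term_order r" using exists_term_order by blast
  from power_dvd_imp_product[OF r assms dvd] obtain V g where V: "finite V"
    "\<forall>v\<in>V. primitive v \<and> positive_exponent r v \<and> g v \<noteq> 0 \<and> power_polynomial (g v)"
    "eq_up_to_unit f (\<Prod>v\<in>V. eval_at (g v) (Poly_Mapping.single v 1))"
    by blast
  obtain e where e: "bij_betw e {1..card V} V"
    using ex_bij_betw_nat_finite_1[OF V(1)] by blast
  let ?\<xi> = "\<lambda>i. Poly_Mapping.single (e i) 1 :: 'd laurent"
  show ?R
  proof (rule exI[of _ r], rule exI[of _ "card V"], rule exI[of _ ?\<xi>], rule exI[of _ "\<lambda>i. g (e i)"], intro conjI ballI)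
    show "term_order r" by (rule r)
    have inj: "u = v" if "Poly_Mapping.single u (1 :: complex) = Poly_Mapping.single v 1" for u v :: "int ^ 'd"
    proof -
      from that have "Poly_Mapping.lookup (Poly_Mapping.single v (1 :: complex)) u = 1"
        by (metis lookup_single_eq)
      then show "u = v" by (simp add: lookup_single when_def split: if_splits)
    qed
    show "inj_on ?\<xi> {1..card V}"
      using bij_betw_imp_inj_on[OF e] by (intro inj_onI) (metis inj inj_onD)
    have "(\<Prod>i = 1..card V. eval_at (g (e i)) (?\<xi> i)) = (\<Prod>v\<in>V. eval_at (g v) (Poly_Mapping.single v 1))"
      using e by (rule prod.reindex_bij_betw)
    with V(3) show "eq_up_to_unit f (\<Prod>i = 1..card V. eval_at (g (e i)) (?\<xi> i))" by simp
    fix i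
    assume "i \<in> {1..card V}"
    then have "e i \<in> V" using bij_betwE[OF e] by blast
    with V(2) show "positive_fraction r (?\<xi> i)" "g (e i) \<noteq> 0" "power_polynomial (g (e i))"
      by (simp_all add: positive_fraction_monomial)
  qed
next
  assume ?R
  then obtain r and k :: nat and \<xi> g where *: "\<forall>i\<in>{1..k}. positive_fraction r (\<xi> i) \<and> g i \<noteq> 0 \<and> power_polynomial (g i)"
      and f: "eq_up_to_unit f (\<Prod>i=1..k. eval_at (g i) (\<xi> i))"
    by blast
  from * have "\<forall>i\<in>{1..k}. \<exists>v. \<xi> i = Poly_Mapping.single v 1"
    unfolding positive_fraction_def by blast
  from bchoice[OF this] obtain v where "\<forall>i\<in>{1..k}. \<xi> i = Poly_Mapping.single (v i) 1" ..
  with f have "eq_up_to_unit f (\<Prod>i=1..k. eval_at (g i) (Poly_Mapping.single (v i) 1))" by simp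
  then have "f dvd power_subst i f" if "i \<ge> 1" for i
    by (rule product_dvd_power_subst) (use * that in simp_all)
  then show ?L by (simp add: power_closed_principal_iff)
next
  show ?U
  proof (intro allI impI conjI; elim conjE)
    fix g :: "complex poly"
    assume g: "g \<noteq> 0" "power_polynomial g"
    let ?a = "cyclotomic_exponent g"
    show "\<exists>a :: nat \<Rightarrow> nat.
              finite {n. n \<ge> 1 \<and> a n \<noteq> 0} \<and>
              (\<forall>m n. m \<ge> 1 \<and> n \<ge> 1 \<and> m dvd n \<longrightarrow> a m \<ge> a n) \<and>
              eq_up_to_unit (to_laurent1 g)
                (to_laurent1 (\<Prod>n\<in>{n. n \<ge> 1 \<and> a n \<noteq> 0}. cyclotomic n ^ a n))"
      using finite_cyclotomic_support[OF g(1)] cyclotomic_exponent_antimono[OF g(2,1)]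
        cyclotomic_factorization[OF g(2,1)] by (intro exI[of _ ?a]) blast
    show "\<exists>ps :: complex poly list.
              (\<forall>p\<in>set ps. psi_polynomial p) \<and>
              eq_up_to_unit (to_laurent1 g) (to_laurent1 (prod_list ps))"
      using psi_factorization[OF g(2,1)] by metis
  qed
qed

end
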